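(* Let $n\ge3$ and $I\subseteq\{1,\ldots,n\}$. Let $\xi_I=\sum_{i\in I}H_i$, and let $\varepsilon_I^1=1$ if $|I\cap\{n-1,n\}|=1$ and $\varepsilon_I^1=0$ otherwise. The unique $I$-canonical element of $SO(2n)$ is $\xi_I+\varepsilon_I^1H_s$, with $s\in\{n-1,n\}\cap I$ (the term $\varepsilon_I^1H_s$ being absent when $\varepsilon_I^1=0$). Moreover, $r_{\rho_1}(\xi_I+\varepsilon_I^1H_s)\le 2n-2$ for the standard representation $\rho_1$, and $r_{\rho_2}(\xi_I+\varepsilon_I^1H_s)\le 4n-6$ for the adjoint representation $\rho_2$.
   Context: General setting. Let $G$ be a compact connected Lie group with Lie algebra $\mathfrak g$, $\mathfrak t\subset\mathfrak g$ a maximal torus (maximal abelian subalgebra), $\alpha_1,\ldots,\alpha_n\in\sqrt{-1}\,\mathfrak t^*$ the positive simple roots for a chosen set of positive roots $\Delta^+$, and $H_1,\ldots,H_n\in\mathfrak t$ the dual basis: $\alpha_i(H_j)=\sqrt{-1}\,\delta_{ij}$. Put $\mathfrak I(G)=\{\xi\in\mathfrak t:\exp_G(2\pi\xi)=e\}$ and $\mathfrak I'(G)=\{\xi\in\mathfrak I(G): \alpha(\xi)/\sqrt{-1}\ge 0 \text{ for all }\alpha\in\Delta^+\}$. For $\xi\in\mathfrak I'(G)$ let $\mathfrak g^\xi_j$ ($j\in\mathbb Z$) be the $\sqrt{-1}\,j$-eigenspace of $\mathrm{ad}\,\xi$ on $\mathfrak g^{\mathbb C}$ and $\mathfrak p_i^\xi=\bigoplus_{j\le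 i}\mathfrak g_j^\xi$. Define a partial order on $\mathfrak I'(G)$ by: $\xi\preceq\xi'$ iff $\mathfrak p^\xi_i\subseteq\mathfrak p^{\xi'}_i$ for all $i\ge 0$ (writing $\xi=\sum n_iH_i$, $\xi'=\sum n_i'H_i$, this is equivalent to $n_i'\le n_i$ for all $i$). For $I\subseteq\{1,\ldots,n\}$ let $\mathfrak C_I=\{\sum_i n_iH_i : n_i\ge 0,\ n_j=0 \text{ iff } j\notin I\}$. An $I$-canonical element of $G$ is a maximal element of $(\mathfrak I'(G)\cap\mathfrak C_I,\preceq)$. Uniton number. If $\rho$ is an irreducible representation of $\mathfrak g^{\mathbb C}$ with highest weight $\omega^*$ and lowest weight $\varpi^*$, then $r_\rho(\xi):=\frac{1}{\sqrt{-1}}\big(\omega^*(\xi)-\varpi^*(\xi)\big)$. The case $(D_n)$, $G=SO(2n)$. With respect to a basis $e_1,\ldots,e_{2n}$ of $\mathbb C^{2n}=(\mathbb R^{2n})^{\mathbb C}$ with $e_{n+i}=\overline{e_i}$, $Q(e_i,e_{n+i})=1$ and all other pairings zero ($Q$ the complex-bilinear extension of the standard inner product of $\mathbb R^{2n}$), $E_i$ is the diagonal matrix with $E_ie_i=\sqrt{-1}e_i$, $E_ie_{n+i}=-\sqrt{-1}e_{n+i}$ and zero on the other basis vectors. $\mathfrak t=\{\sum a_iE_i:a_i\in\mathbb R\}$, $L_i(E_j)=\sqrt{-1}\,\delta_{ij}$. The positive roots are $\Delta^+=\{L_i\pm L_j\}_{i<j}$, with simple roots $\alpha_i=L_i-L_{i+1}$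 for $1\le i\le n-1$ and $\alpha_n=L_{n-1}+L_n$, so that $H_i=E_1+\ldots+E_i$ for $1\le i\le n-2$, $H_{n-1}=\frac12(E_1+\ldots+E_{n-1}-E_n)$ and $H_n=\frac12(E_1+\ldots+E_{n-1}+E_n)$. The standard representation $\rho_1$ has highest weight $L_1$, and the adjoint representation $\rho_2$ has highest weight $L_1+L_2$. *)

theory Defs
  imports "Jordan_Normal_Form.Determinant" "HOL-Library.FuncSet"
begin

text \<open>
  All matrices are taken with respect to the basis \<open>e\<^sub>1, \<dots>, e\<^sub>2\<^sub>n\<close> of \<open>\<complex>\<^sup>2\<^sup>n\<close> with
  \<open>e\<^sub>n\<^sub>+\<^sub>i = cnj e\<^sub>i\<close> and \<open>Q(e\<^sub>i, e\<^sub>n\<^sub>+\<^sub>i) = 1\<close>, all other pairings being zero.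
  The vector \<open>e\<^sub>k\<close> corresponds to the matrix index \<open>k - 1\<close>; the indices of
  \<open>E\<^sub>i\<close>, \<open>L\<^sub>i\<close>, \<open>\<alpha>\<^sub>i\<close>, \<open>H\<^sub>i\<close> run from 1 to n. Inequalities between complex numbers refer to
  \<^theory>\<open>HOL-Library.Complex_Order\<close>: \<open>z \<le> w\<close> includes equality of the imaginary parts,
  so that \<open>0 \<le> z\<close> says that \<open>z\<close> is a nonnegative real.
\<close>

section \<open>The group, its Lie algebra and the maximal torus\<close>

text \<open>
  The Gram matrix of \<open>Q\<close>. It is also the matrix of complex conjugation: in coordinates, the
  conjugate of \<open>v\<close> is \<open>gram n *\<^sub>v map_vec cnj v\<close>. Hence \<open>gram n * map_mat cnj A * gram n = A\<close>
  says that \<open>A\<close> maps the real points \<open>\<real>\<^sup>2\<^sup>n\<close> to themselves.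
\<close>

definition gram :: "nat \<Rightarrow> complex mat" where
  "gram n = mat (2*n) (2*n) (\<lambda>(r, c). if r = c + n \<or> c = r + n then 1 else 0)"

definition SO_2n :: "nat \<Rightarrow> complex mat monoid" where
  "SO_2n n = \<lparr>
     carrier = {A \<in> carrier_mat (2*n) (2*n).
       gram n * map_mat cnj A * gram n = A \<and>
       transpose_mat A * gram n * A = gram n \<and> det A = 1},
     mult = (*),
     one = 1\<^sub>m (2*n)\<rparr>"

definition so_2n :: "nat \<Rightarrow> complex mat set" where
  "so_2n n = {A \<in> carrier_mat (2*n) (2*n).
     gram n * map_mat cnj A * gram n = A \<and>
     transpose_mat A * gram n + gram n * A = 0\<^sub>m (2*n) (2*n)}"

text \<open>The complexified Lie algebra, as a complex vector space.\<close>

definition so_2n_C :: "nat \<Rightarrow> (complex, complex mat) module" where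
  "so_2n_C n = module_mat TYPE(complex) (2*n) (2*n)
     \<lparr>carrier := {A + \<i> \<cdot>\<^sub>m B | A B. A \<in> so_2n n \<and> B \<in> so_2n n}\<rparr>"

definition mat_exp :: "complex mat \<Rightarrow> complex mat" where
  "mat_exp A = mat (dim_row A) (dim_row A) (\<lambda>(r, c). \<Sum>k. (A ^\<^sub>m k) $$ (r, c) / fact k)"

definition E :: "nat \<Rightarrow> nat \<Rightarrow> complex mat" where
  "E n i = mat (2*n) (2*n) (\<lambda>(r, c).
     if r = c \<and> Suc r = i then \<i>
     else if r = c \<and> Suc r = n + i then - \<i>
     else 0)"

definition lincomb_2n :: "nat \<Rightarrow> (nat \<Rightarrow> complex) \<Rightarrow> (nat \<Rightarrow> complex mat) \<Rightarrow> nat set \<Rightarrow> complex mat" where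
  "lincomb_2n n a X K =
     finsum (module_mat TYPE(complex) (2*n) (2*n)) (\<lambda>i. a i \<cdot>\<^sub>m X i) K"

definition torus :: "nat \<Rightarrow> complex mat set" where
  "torus n = {lincomb_2n n (\<lambda>i. complex_of_real (a i)) (E n) {1..n} | a :: nat \<Rightarrow> real. True}"

section \<open>Roots and the dual basis\<close>

text \<open>Only the values on \<open>torus n\<close> are meaningful for the functionals below.\<close>

definition L :: "nat \<Rightarrow> complex mat \<Rightarrow> complex" where
  "L i \<xi> = \<xi> $$ (i - 1, i - 1)"

definition positive_roots :: "nat \<Rightarrow> (complex mat \<Rightarrow> complex) set" where
  "positive_roots n =
     {\<lambda>\<xi>. L i \<xi> + L j \<xi> | i j. 1 \<le> i \<and> i < j \<and> j \<le> n} \<union>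
     {\<lambda>\<xi>. L i \<xi> - L j \<xi> | i j. 1 \<le> i \<and> i < j \<and> j \<le> n}"

definition simple_root :: "nat \<Rightarrow> nat \<Rightarrow> complex mat \<Rightarrow> complex" where
  "simple_root n i =
     (if i < n then (\<lambda>\<xi>. L i \<xi> - L (i + 1) \<xi>) else (\<lambda>\<xi>. L (n - 1) \<xi> + L n \<xi>))"

definition H :: "nat \<Rightarrow> nat \<Rightarrow> complex mat" where
  "H n i =
     (if i \<le> n - 2 then lincomb_2n n (\<lambda>_. 1) (E n) {1..i}
      else if i = n - 1 then (1/2) \<cdot>\<^sub>m (lincomb_2n n (\<lambda>_. 1) (E n) {1..n-1} - E n n)
      else (1/2) \<cdot>\<^sub>m (lincomb_2n n (\<lambda>_. 1) (E n) {1..n-1} + E n n))"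

section \<open>Canonical elements\<close>

definition integral_lattice :: "nat \<Rightarrow> complex mat set" where
  "integral_lattice n =
     {\<xi> \<in> torus n. mat_exp (complex_of_real (2 * pi) \<cdot>\<^sub>m \<xi>) = \<one>\<^bsub>SO_2n n\<^esub>}"

definition dominant_lattice :: "nat \<Rightarrow> complex mat set" where
  "dominant_lattice n =
     {\<xi> \<in> integral_lattice n. \<forall>\<alpha> \<in> positive_roots n. 0 \<le> \<alpha> \<xi> / \<i>}"

definition ad :: "complex mat \<Rightarrow> complex mat \<Rightarrow> complex mat" where
  "ad X Y = X * Y - Y * X"

definition eigenspace_ad :: "nat \<Rightarrow> complex mat \<Rightarrow> int \<Rightarrow> complex mat set" where
  "eigenspace_ad n \<xi> j = {X \<in> carrier (so_2n_C n). ad \<xi> X = (\<i> * of_int j) \<cdot>\<^sub>m X}"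

text \<open>The sum of the eigenspaces with index at most \<open>i\<close>, as the set of all finite sums.\<close>

definition parabolic :: "nat \<Rightarrow> complex mat \<Rightarrow> int \<Rightarrow> complex mat set" where
  "parabolic n \<xi> i = {finsum (so_2n_C n) X J | X J.
     finite J \<and> J \<subseteq> {..i} \<and> X \<in> (\<Pi> j \<in> J. eigenspace_ad n \<xi> j)}"

definition preceq :: "nat \<Rightarrow> complex mat \<Rightarrow> complex mat \<Rightarrow> bool" where
  "preceq n \<xi> \<xi>' \<longleftrightarrow> (\<forall>i \<ge> 0. parabolic n \<xi> i \<subseteq> parabolic n \<xi>' i)"

definition cone :: "nat \<Rightarrow> nat set \<Rightarrow> complex mat set" where
  "cone n I = {lincomb_2n n (\<lambda>i. complex_of_real (a i)) (H n) {1..n} | a :: nat \<Rightarrow> real.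
     \<forall>j \<in> {1..n}. a j \<ge> 0 \<and> (a j = 0 \<longleftrightarrow> j \<notin> I)}"

definition canonical :: "nat \<Rightarrow> nat set \<Rightarrow> complex mat \<Rightarrow> bool" where
  "canonical n I \<xi> \<longleftrightarrow>
     \<xi> \<in> dominant_lattice n \<inter> cone n I \<and>
     (\<forall>\<xi>' \<in> dominant_lattice n \<inter> cone n I. preceq n \<xi> \<xi>' \<longrightarrow> \<xi>' = \<xi>)"

section \<open>Weights of representations\<close>

text \<open>
  A representation of \<open>so(2n, \<complex>)\<close> is given by its space \<open>V\<close> and its action \<open>\<rho>\<close>. Weights are
  functionals on the torus; extensionality makes them determined by their values there.
\<close>

definition weights ::
  "nat \<Rightarrow> (complex, 'v) module \<Rightarrow> (complex mat \<Rightarrow> 'v \<Rightarrow> 'v) \<Rightarrow> (complex mat \<Rightarrow> complex) set" where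
  "weights n V \<rho> = {\<omega> \<in> extensional (torus n).
     \<exists>v \<in> carrier V - {\<zero>\<^bsub>V\<^esub>}. \<forall>\<xi> \<in> torus n. \<rho> \<xi> v = \<omega> \<xi> \<odot>\<^bsub>V\<^esub> v}"

definition weight_le ::
  "nat \<Rightarrow> (complex mat \<Rightarrow> complex) \<Rightarrow> (complex mat \<Rightarrow> complex) \<Rightarrow> bool" where
  "weight_le n \<mu> \<nu> \<longleftrightarrow> (\<exists>k :: nat \<Rightarrow> nat. \<forall>\<xi> \<in> torus n.
     \<nu> \<xi> - \<mu> \<xi> = (\<Sum>i = 1..n. of_nat (k i) * simple_root n i \<xi>))"

definition highest_weight ::
  "nat \<Rightarrow> (complex, 'v) module \<Rightarrow> (complex mat \<Rightarrow> 'v \<Rightarrow> 'v) \<Rightarrow> complex mat \<Rightarrow> complex" where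
  "highest_weight n V \<rho> =
     (THE \<omega>. \<omega> \<in> weights n V \<rho> \<and> (\<forall>\<mu> \<in> weights n V \<rho>. weight_le n \<mu> \<omega>))"

definition lowest_weight ::
  "nat \<Rightarrow> (complex, 'v) module \<Rightarrow> (complex mat \<Rightarrow> 'v \<Rightarrow> 'v) \<Rightarrow> complex mat \<Rightarrow> complex" where
  "lowest_weight n V \<rho> =
     (THE \<omega>. \<omega> \<in> weights n V \<rho> \<and> (\<forall>\<mu> \<in> weights n V \<rho>. weight_le n \<omega> \<mu>))"

definition uniton_r ::
  "nat \<Rightarrow> (complex, 'v) module \<Rightarrow> (complex mat \<Rightarrow> 'v \<Rightarrow> 'v) \<Rightarrow> complex mat \<Rightarrow> complex" where
  "uniton_r n V \<rho> \<xi> = (1 / \<i>) * (highest_weight n V \<rho> \<xi> - lowest_weight n V \<rho> \<xi>)"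

abbreviation r_standard :: "nat \<Rightarrow> complex mat \<Rightarrow> complex" where
  "r_standard n \<equiv> uniton_r n (module_vec TYPE(complex) (2*n)) (\<lambda>X v. X *\<^sub>v v)"

abbreviation r_adjoint :: "nat \<Rightarrow> complex mat \<Rightarrow> complex" where
  "r_adjoint n \<equiv> uniton_r n (so_2n_C n) ad"

section \<open>The explicit element\<close>

definition xi :: "nat \<Rightarrow> nat set \<Rightarrow> complex mat" where
  "xi n I = lincomb_2n n (\<lambda>_. 1) (H n) I"

definition eps :: "nat \<Rightarrow> nat set \<Rightarrow> nat" where
  "eps n I = (if card (I \<inter> {n-1, n}) = 1 then 1 else 0)"

end

theory Submission
  imports Defs
begin

text \<open>
  Write a torus element as \<open>\<xi> = \<Sum>\<^sub>k a\<^sub>k E\<^sub>k = \<Sum>\<^sub>i c\<^sub>i H\<^sub>i\<close>; then \<open>\<i> c\<^sub>i\<close> is the value of the simple root \<open>\<alpha>\<^sub>i\<close>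
  on \<open>\<xi>\<close>. The element lies in the integral lattice when all \<open>a\<^sub>k\<close> are integers, which in terms of
  the \<open>c\<^sub>i\<close> means that they are integers and that \<open>c\<^sub>n\<^sub>-\<^sub>1 + c\<^sub>n\<close> is even (\<open>integral_coords_iff\<close>). It is
  dominant when all \<open>c\<^sub>i\<close> are nonnegative, and it lies in the cone of \<open>I\<close> when moreover exactly the
  \<open>c\<^sub>i\<close> with \<open>i \<in> I\<close> are nonzero.

  On dominant lattice elements the order \<open>\<preceq>\<close> is the reversed coefficientwise order
  (\<open>preceq_torus_eltI\<close>, \<open>preceq_torus_eltD\<close>). The torus acts on the Lie algebra entry by entry, so
  membership in a parabolic is a condition on which entries may be nonzero
  (\<open>parabolic_torus_elt\<close>); since every root or its negative is a sum of simple roots, this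
  condition is monotone in the \<open>c\<^sub>i\<close>, and the simple root vectors detect each \<open>c\<^sub>i\<close>. Canonical
  elements are therefore the coefficientwise minimal ones, and there is a smallest one: take
  \<open>c\<^sub>i = 1\<close> on \<open>I\<close>, and if exactly one \<open>s\<close> of \<open>n - 1\<close> and \<open>n\<close> is in \<open>I\<close>, the parity condition raises \<open>c\<^sub>s\<close>
  to 2 (\<open>least\<close>).

  The weights of the standard representation are \<open>\<plusminus>L\<^sub>i\<close>, with extreme ones \<open>\<plusminus>L\<^sub>1\<close>, and those of the
  adjoint representation are the roots and zero, with extreme ones \<open>\<plusminus>(L\<^sub>1 + L\<^sub>2)\<close>. Hence the two
  uniton numbers are \<open>2 a\<^sub>1\<close> and \<open>2 (a\<^sub>1 + a\<^sub>2)\<close>. For the canonical element \<open>a\<^sub>n\<^sub>-\<^sub>1 \<le> 1\<close> and consecutive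
  coordinates up to \<open>a\<^sub>n\<^sub>-\<^sub>1\<close> differ by at most 1, so \<open>a\<^sub>1 \<le> n - 1\<close> and \<open>a\<^sub>2 \<le> n - 2\<close>
  (\<open>coord_le\<close>), which are the two bounds.
\<close>

section \<open>Coordinates on the torus\<close>

text \<open>
  The index of the basis vector conjugate to the one with index \<open>r\<close>, which is also the one dual
  to it under \<open>Q\<close>.
\<close>

definition conj_index :: "nat \<Rightarrow> nat \<Rightarrow> nat" where
  "conj_index n r = (if r < n then r + n else r - n)"

text \<open>
  Divided by \<open>\<i>\<close>, the eigenvalue of \<open>\<Sum>\<^sub>i a\<^sub>i E\<^sub>i\<close> on the basis vector with index \<open>r\<close>. As functionals of
  \<open>a\<close> these are the weights \<open>L\<^sub>i\<close> (for \<open>r < n\<close>) and \<open>-L\<^sub>i\<close> of the standard representation. Matrix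
  indices start at 0 and the indices of \<open>a\<close> at 1.
\<close>

definition coord :: "nat \<Rightarrow> nat \<Rightarrow> (nat \<Rightarrow> real) \<Rightarrow> real" where
  "coord n r a = (if r < n then a (r + 1) else - a (r - n + 1))"

definition torus_elt :: "nat \<Rightarrow> (nat \<Rightarrow> real) \<Rightarrow> complex mat" where
  "torus_elt n a = mat (2*n) (2*n) (\<lambda>(r, c). if r = c then \<i> * of_real (coord n r a) else 0)"

lemma torus_elt_carrier [simp]: "torus_elt n a \<in> carrier_mat (2*n) (2*n)"
  and torus_elt_dim [simp]: "dim_row (torus_elt n a) = 2*n" "dim_col (torus_elt n a) = 2*n"
  and torus_elt_index: "r < 2*n \<Longrightarrow> c < 2*n \<Longrightarrow>
    torus_elt n a $$ (r, c) = (if r = c then \<i> * of_real (coord n r a) else 0)"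
  by (auto simp: torus_elt_def)

lemma conj_index_less [simp]: "r < 2*n \<Longrightarrow> conj_index n r < 2*n"
  and conj_index_conj_index [simp]: "r < 2*n \<Longrightarrow> conj_index n (conj_index n r) = r"
  and conj_index_neq [simp]: "r < 2*n \<Longrightarrow> conj_index n r \<noteq> r"
  and coord_conj_index [simp]: "r < 2*n \<Longrightarrow> coord n (conj_index n r) a = - coord n r a"
  by (auto simp: conj_index_def coord_def)

lemma coord_add: "coord n r (\<lambda>k. a k + b k) = coord n r a + coord n r b"
  and coord_scale: "coord n r (\<lambda>k. t * a k) = t * coord n r a"
  and coord_diff: "coord n r (\<lambda>k. a k - b k) = coord n r a - coord n r b"
  by (auto simp: coord_def)

lemma coord_sum: "coord n r (\<lambda>k. \<Sum>i\<in>K. c i * b i k) = (\<Sum>i\<in>K. c i * coord n r (b i))"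
  by (auto simp: coord_def sum_negf)

lemma torus_elt_eqI: "(\<And>k. k \<in> {1..n} \<Longrightarrow> a k = b k) \<Longrightarrow> torus_elt n a = torus_elt n b"
  by (intro eq_matI) (auto simp: torus_elt_index coord_def)

lemma torus_elt_add: "torus_elt n a + torus_elt n b = torus_elt n (\<lambda>k. a k + b k)"
  and torus_elt_diff: "torus_elt n a - torus_elt n b = torus_elt n (\<lambda>k. a k - b k)"
  and torus_elt_smult: "of_real t \<cdot>\<^sub>m torus_elt n a = torus_elt n (\<lambda>k. t * a k)"
  by (rule eq_matI; auto simp: torus_elt_index coord_add coord_diff coord_scale algebra_simps)+

lemma L_torus_elt:
  assumes "i \<in> {1..n}"
  shows "L i (torus_elt n a) = \<i> * of_real (a i)"
  using assms by (auto simp: L_def torus_elt_index coord_def)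

lemma lincomb_2n_index:
  assumes "finite K" "\<And>i. i \<in> K \<Longrightarrow> X i \<in> carrier_mat (2*n) (2*n)"
  shows "lincomb_2n n a X K \<in> carrier_mat (2*n) (2*n) \<and>
    (\<forall>r<2*n. \<forall>c<2*n. lincomb_2n n a X K $$ (r, c) = (\<Sum>i\<in>K. a i * X i $$ (r, c)))"
  using assms
proof (induction K rule: finite_induct)
  case empty
  interpret abelian_group "module_mat TYPE(complex) (2*n) (2*n)" by (rule abelian_group_mat)
  show ?case unfolding lincomb_2n_def by (simp add: module_mat_simps)
next
  case (insert i K)
  interpret M: abelian_group "module_mat TYPE(complex) (2*n) (2*n)" by (rule abelian_group_mat)
  have "lincomb_2n n a X (insert i K) = a i \<cdot>\<^sub>m X i + lincomb_2n n a X K"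
    unfolding lincomb_2n_def using insert
    by (subst M.finsum_insert) (auto simp: module_mat_simps)
  moreover have "dim_row (X i) = 2*n" "dim_col (X i) = 2*n" using insert.prems[of i] by auto
  ultimately show ?case using insert by auto
qed

lemma lincomb_2n_torus_elt:
  assumes "finite K" "\<And>i. i \<in> K \<Longrightarrow> X i = torus_elt n (b i)" "\<And>i. i \<in> K \<Longrightarrow> z i = of_real (c i)"
  shows "lincomb_2n n z X K = torus_elt n (\<lambda>k. \<Sum>i\<in>K. c i * b i k)"
proof -
  have X: "\<And>i. i \<in> K \<Longrightarrow> X i \<in> carrier_mat (2*n) (2*n)" using assms by auto
  note I = lincomb_2n_index[of K X n z, OF assms(1) X]
  show ?thesis
  proof (rule eq_matI)
    fix r s assume "r < dim_row (torus_elt n (\<lambda>k. \<Sum>i\<in>K. c i * b i k))"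
      "s < dim_col (torus_elt n (\<lambda>k. \<Sum>i\<in>K. c i * b i k))"
    then have rs: "r < 2*n" "s < 2*n" by auto
    then have "lincomb_2n n z X K $$ (r, s) = (\<Sum>i\<in>K. of_real (c i) * torus_elt n (b i) $$ (r, s))"
      using I assms by (auto intro!: sum.cong)
    also have "\<dots> = torus_elt n (\<lambda>k. \<Sum>i\<in>K. c i * b i k) $$ (r, s)"
      using rs by (auto simp: torus_elt_index coord_sum sum_distrib_left algebra_simps)
    finally show "lincomb_2n n z X K $$ (r, s) = torus_elt n (\<lambda>k. \<Sum>i\<in>K. c i * b i k) $$ (r, s)" .
  qed (use I in auto)
qed

lemma E_eq_torus_elt: "i \<in> {1..n} \<Longrightarrow> E n i = torus_elt n (\<lambda>k. of_bool (k = i))"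
  by (intro eq_matI) (auto simp: E_def torus_elt_def coord_def)

lemma torus_eq: "torus n = range (torus_elt n)"
proof -
  have "lincomb_2n n (\<lambda>i. complex_of_real (a i)) (E n) {1..n} = torus_elt n a" for a
  proof -
    have "lincomb_2n n (\<lambda>i. complex_of_real (a i)) (E n) {1..n} =
        torus_elt n (\<lambda>k. \<Sum>i=1..n. a i * of_bool (k = i))"
      by (intro lincomb_2n_torus_elt) (auto intro: E_eq_torus_elt)
    also have "\<dots> = torus_elt n a" by (intro torus_elt_eqI) (simp add: of_bool_def if_distrib[of "(*) _"] cong: if_cong)
    finally show ?thesis .
  qed
  then show ?thesis by (auto simp: torus_def)
qed

lemma torus_elt_in_torus [simp]: "torus_elt n a \<in> torus n"
  by (simp add: torus_eq)

lemma torus_eltE: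
  assumes "\<xi> \<in> torus n"
  obtains a where "\<xi> = torus_elt n a"
  using assms by (auto simp: torus_eq)

text \<open>
  The \<open>k\<close>-th coordinate of \<open>H\<^sub>i\<close> in the basis \<open>E\<^sub>1, \<dots>, E\<^sub>n\<close> of the torus.
\<close>

definition H_coord :: "nat \<Rightarrow> nat \<Rightarrow> nat \<Rightarrow> real" where
  "H_coord n i k =
     (if i \<le> n - 2 then of_bool (k \<le> i)
      else if i = n - 1 \<and> k = n then - 1/2 else 1/2)"

lemma H_eq_torus_elt:
  assumes "n \<ge> 2"
  shows "H n i = torus_elt n (H_coord n i)"
proof -
  have sum1: "lincomb_2n n (\<lambda>_. 1) (E n) {1..m} = torus_elt n (\<lambda>k. of_bool (k \<le> m))" if "m \<le> n" for m
  proof -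
    have "lincomb_2n n (\<lambda>_. 1) (E n) {1..m} = torus_elt n (\<lambda>k. \<Sum>i=1..m. 1 * of_bool (k = i))"
      using that by (intro lincomb_2n_torus_elt) (auto intro: E_eq_torus_elt)
    also have "\<dots> = torus_elt n (\<lambda>k. of_bool (k \<le> m))"
      by (intro torus_elt_eqI) (auto simp: of_bool_def)
    finally show ?thesis .
  qed
  have half: "(1/2) \<cdot>\<^sub>m torus_elt n b = torus_elt n (\<lambda>k. 1/2 * b k)" for b
    using torus_elt_smult[of "1/2" n b] by simp
  show ?thesis using assms
    by (auto simp: H_def H_coord_def sum1 E_eq_torus_elt torus_elt_add torus_elt_diff half
        simp del: One_nat_def intro!: torus_elt_eqI)
qed

section \<open>Roots in coordinates\<close>

text \<open>
  Divided by \<open>\<i>\<close>, the value of the simple root \<open>\<alpha>\<^sub>i\<close> on \<open>\<Sum>\<^sub>k a\<^sub>k E\<^sub>k\<close>; equivalently, its coefficient at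
  \<open>H\<^sub>i\<close>.
\<close>

definition simple_coord :: "nat \<Rightarrow> nat \<Rightarrow> (nat \<Rightarrow> real) \<Rightarrow> real" where
  "simple_coord n i a = (if i < n then a i - a (i + 1) else a (n - 1) + a n)"

lemma simple_root_torus_elt:
  assumes "n \<ge> 2" "i \<in> {1..n}"
  shows "simple_root n i (torus_elt n a) = \<i> * of_real (simple_coord n i a)"
  using assms by (auto simp: simple_root_def simple_coord_def L_torus_elt algebra_simps)

text \<open>
  The relation \<open>\<alpha>\<^sub>i(H\<^sub>j) = \<i> \<delta>\<^sub>i\<^sub>j\<close>: it makes the values of the simple roots the coefficients with respect
  to the \<open>H\<^sub>j\<close>, so that the cones become sign conditions on the simple roots.
\<close>

lemma simple_coord_H_coord:
  assumes "n \<ge> 2" "i \<in> {1..n}" "j \<in> {1..n}"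
  shows "simple_coord n i (H_coord n j) = of_bool (i = j)"
  using assms by (auto simp: simple_coord_def H_coord_def)

lemma simple_coord_sum_H_coord:
  assumes "n \<ge> 2" "i \<in> {1..n}"
  shows "simple_coord n i (\<lambda>k. \<Sum>j=1..n. c j * H_coord n j k) = c i"
proof -
  have "simple_coord n i (\<lambda>k. \<Sum>j=1..n. c j * H_coord n j k) = (\<Sum>j=1..n. c j * simple_coord n i (H_coord n j))"
    by (auto simp: simple_coord_def sum_subtractf sum.distrib algebra_simps)
  also have "\<dots> = (\<Sum>j=1..n. c j * of_bool (i = j))"
    using assms by (intro sum.cong) (auto simp: simple_coord_H_coord)
  also have "\<dots> = c i" using assms by (simp add: of_bool_def if_distrib[of "(*) _"] cong: if_cong)
  finally show ?thesis .
qed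

text \<open>
  The functionals in the cone that the simple roots span over the natural numbers. All positivity
  below goes through this cone: it contains the positive roots, and the differences between a
  highest weight and any other weight lie in it.
\<close>

definition simple_comb :: "nat \<Rightarrow> ((nat \<Rightarrow> real) \<Rightarrow> real) \<Rightarrow> bool" where
  "simple_comb n f \<longleftrightarrow> (\<exists>k :: nat \<Rightarrow> nat. \<forall>a. f a = (\<Sum>i=1..n. real (k i) * simple_coord n i a))"

lemma simple_comb_zero: "simple_comb n (\<lambda>a. 0)"
  unfolding simple_comb_def by (rule exI[of _ "\<lambda>_. 0"]) simp

lemma simple_comb_add: "simple_comb n f \<Longrightarrow> simple_comb n g \<Longrightarrow> simple_comb n (\<lambda>a. f a + g a)"
proof -
  assume "simple_comb n f" "simple_comb n g"
  then obtain k l where "\<forall>a. f a = (\<Sum>i=1..n. real (k i) * simple_coord n i a)"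
    "\<forall>a. g a = (\<Sum>i=1..n. real (l i) * simple_coord n i a)" unfolding simple_comb_def by blast
  then show ?thesis unfolding simple_comb_def
    by (intro exI[of _ "\<lambda>i. k i + l i"]) (simp add: sum.distrib algebra_simps)
qed

lemma simple_comb_simple: "i \<in> {1..n} \<Longrightarrow> simple_comb n (simple_coord n i)"
  unfolding simple_comb_def
  by (rule exI[of _ "\<lambda>j. of_bool (j = i)"]) (auto simp: of_bool_def if_distrib[of real] if_distrib[of "\<lambda>x. x * _"] cong: if_cong)

lemma simple_comb_mono:
  assumes "simple_comb n f" "\<And>i. i \<in> {1..n} \<Longrightarrow> simple_coord n i a \<le> simple_coord n i b"
  shows "f a \<le> f b"
  using assms unfolding simple_comb_def by (force intro!: sum_mono mult_left_mono)

lemma simple_comb_nonneg: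
  assumes "simple_comb n f" "\<And>i. i \<in> {1..n} \<Longrightarrow> 0 \<le> simple_coord n i a"
  shows "0 \<le> f a"
  using assms unfolding simple_comb_def by (force intro!: sum_nonneg mult_nonneg_nonneg)

text \<open>
  Telescoping: \<open>L\<^sub>i - L\<^sub>j = \<alpha>\<^sub>i + \<dots> + \<alpha>\<^sub>j\<^sub>-\<^sub>1\<close>.
\<close>

lemma simple_comb_diff:
  assumes "1 \<le> i" "i \<le> j" "j \<le> n"
  shows "simple_comb n (\<lambda>a. a i - a j)"
  using assms(2,3)
proof (induction j rule: dec_induct)
  case base then show ?case by (simp add: simple_comb_zero)
next
  case (step j)
  then have "simple_comb n (\<lambda>a. (a i - a j) + simple_coord n j a)"
    using assms by (intro simple_comb_add simple_comb_simple) auto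
  then show ?case using step by (simp add: simple_coord_def)
qed

text \<open>
  The identity \<open>L\<^sub>i + L\<^sub>j = (L\<^sub>i - L\<^sub>n\<^sub>-\<^sub>1) + (L\<^sub>j - L\<^sub>n) + \<alpha>\<^sub>n\<close> applies as soon as \<open>i\<close> or \<open>j\<close> differs
  from \<open>n\<close>. The exception is genuine: \<open>2 L\<^sub>n = \<alpha>\<^sub>n - \<alpha>\<^sub>n\<^sub>-\<^sub>1\<close>.
\<close>

lemma simple_comb_sum:
  assumes "1 \<le> i" "1 \<le> j" "i \<le> n" "j \<le> n" "\<not> (i = n \<and> j = n)"
  shows "simple_comb n (\<lambda>a. a i + a j)"
proof -
  have *: "simple_comb n (\<lambda>a. a i + a j)" if "1 \<le> i" "1 \<le> j" "i < n" "j \<le> n" for i j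
  proof -
    have "simple_comb n (\<lambda>a. ((a i - a (n - 1)) + (a j - a n)) + simple_coord n n a)"
      using that by (intro simple_comb_add simple_comb_diff simple_comb_simple) auto
    then show ?thesis using that by (simp add: simple_coord_def)
  qed
  show ?thesis
    using *[of i j] *[of j i] assms by (cases "i < n") (auto simp: add.commute)
qed

text \<open>
  The weight of the matrix entry \<open>(r, s)\<close> under the torus. The excluded entries, of weight \<open>\<plusminus>2 L\<^sub>i\<close>,
  vanish for every element of the Lie algebra; the others have weight zero or a root.
\<close>

lemma root_positive_or_negative:
  assumes "r < 2*n" "s < 2*n" "r \<noteq> conj_index n s"
  shows "simple_comb n (\<lambda>a. coord n r a - coord n s a) \<or> simple_comb n (\<lambda>a. coord n s a - coord n r a)"
proof -
  have d: "simple_comb n (\<lambda>a. a i - a j) \<or> simple_comb n (\<lambda>a. a j - a i)"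
    if "i \<in> {1..n}" "j \<in> {1..n}" for i j
    using that simple_comb_diff[of i j n] simple_comb_diff[of j i n] by (cases "i \<le> j") auto
  show ?thesis
  proof (cases "r < n"; cases "s < n")
    assume "r < n" "s < n"
    then show ?thesis using d[of "r+1" "s+1"] by (simp add: coord_def)
  next
    assume "r < n" "\<not> s < n"
    then show ?thesis using simple_comb_sum[of "r+1" "s-n+1" n] assms
      by (auto simp: coord_def conj_index_def)
  next
    assume "\<not> r < n" "s < n"
    moreover from this have "r - n + 1 \<le> n" "\<not> (s + 1 = n \<and> r - n + 1 = n)"
      using assms by (auto simp: conj_index_def)
    ultimately show ?thesis using simple_comb_sum[of "s+1" "r-n+1" n]
      by (simp add: coord_def)
  next
    assume "\<not> r < n" "\<not> s < n"
    then show ?thesis using d[of "s-n+1" "r-n+1"] assms by (auto simp: coord_def)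
  qed
qed

section \<open>The integral lattice and the cones\<close>

text \<open>
  The simple roots form a basis of the dual of the torus: \<open>\<alpha>\<^sub>n\<^sub>-\<^sub>1\<close> and \<open>\<alpha>\<^sub>n\<close> together give \<open>L\<^sub>n\<close>, and
  \<open>L\<^sub>k - L\<^sub>n\<close> is a sum of simple roots.
\<close>

lemma coords_determined:
  assumes "n \<ge> 2" "\<And>i. i \<in> {1..n} \<Longrightarrow> simple_coord n i a = simple_coord n i b" "k \<in> {1..n}"
  shows "a k = b k"
proof -
  have "simple_coord n (n - 1) a = simple_coord n (n - 1) b" "simple_coord n n a = simple_coord n n b"
    using assms by auto
  then have "a n = b n" using assms(1) by (simp add: simple_coord_def)
  moreover have "simple_comb n (\<lambda>a. a k - a n)" using assms by (intro simple_comb_diff) auto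
  then have "a k - a n = b k - b n"
    using assms(2) by (intro antisym simple_comb_mono[of n "\<lambda>a. a k - a n"]) auto
  ultimately show ?thesis by simp
qed

lemma torus_elt_inject:
  "torus_elt n a = torus_elt n b \<longleftrightarrow> (\<forall>k\<in>{1..n}. a k = b k)"
proof
  assume "torus_elt n a = torus_elt n b"
  then show "\<forall>k\<in>{1..n}. a k = b k" by (metis L_torus_elt complex_i_not_zero mult_cancel_left of_real_eq_iff)
qed (auto intro: torus_elt_eqI)

lemma torus_elt_eq_simpleI:
  assumes "n \<ge> 2" "\<And>i. i \<in> {1..n} \<Longrightarrow> simple_coord n i a = simple_coord n i b"
  shows "torus_elt n a = torus_elt n b"
  by (rule torus_elt_eqI) (rule coords_determined[OF assms])

lemma simple_coord_cong:
  "n \<ge> 2 \<Longrightarrow> i \<in> {1..n} \<Longrightarrow> (\<And>k. k \<in> {1..n} \<Longrightarrow> a k = b k) \<Longrightarrow> simple_coord n i a = simple_coord n i b"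
  by (auto simp: simple_coord_def)

lemma lincomb_H_eq:
  assumes "n \<ge> 2"
  shows "lincomb_2n n (\<lambda>i. complex_of_real (c i)) (H n) {1..n} =
    torus_elt n (\<lambda>k. \<Sum>j=1..n. c j * H_coord n j k)"
  using assms by (intro lincomb_2n_torus_elt) (auto simp: H_eq_torus_elt)

lemma torus_elt_in_cone_iff:
  assumes "n \<ge> 2"
  shows "torus_elt n a \<in> cone n I \<longleftrightarrow>
    (\<forall>j\<in>{1..n}. simple_coord n j a \<ge> 0 \<and> (simple_coord n j a = 0 \<longleftrightarrow> j \<notin> I))"
proof
  assume "torus_elt n a \<in> cone n I"
  then obtain c where c: "torus_elt n a = torus_elt n (\<lambda>k. \<Sum>j=1..n. c j * H_coord n j k)"
    "\<forall>j\<in>{1..n}. c j \<ge> 0 \<and> (c j = 0 \<longleftrightarrow> j \<notin> I)"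
    using assms unfolding cone_def lincomb_H_eq[OF assms] by blast
  have "simple_coord n j a = c j" if "j \<in> {1..n}" for j
  proof -
    have "simple_coord n j a = simple_coord n j (\<lambda>k. \<Sum>j=1..n. c j * H_coord n j k)"
      using c(1) assms that unfolding torus_elt_inject by (intro simple_coord_cong) auto
    then show ?thesis using assms that by (simp only: simple_coord_sum_H_coord)
  qed
  then show "\<forall>j\<in>{1..n}. simple_coord n j a \<ge> 0 \<and> (simple_coord n j a = 0 \<longleftrightarrow> j \<notin> I)"
    using c(2) by auto
next
  assume *: "\<forall>j\<in>{1..n}. simple_coord n j a \<ge> 0 \<and> (simple_coord n j a = 0 \<longleftrightarrow> j \<notin> I)"
  have "torus_elt n a = torus_elt n (\<lambda>k. \<Sum>j=1..n. simple_coord n j a * H_coord n j k)"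
  proof (rule torus_elt_eqI)
    fix k assume k: "k \<in> {1..n}"
    show "a k = (\<Sum>j=1..n. simple_coord n j a * H_coord n j k)"
      by (rule coords_determined[OF assms _ k]) (rule simple_coord_sum_H_coord[OF assms, symmetric])
  qed
  also have "\<dots> = lincomb_2n n (\<lambda>j. complex_of_real (simple_coord n j a)) (H n) {1..n}"
    by (rule lincomb_H_eq[OF assms, symmetric])
  finally show "torus_elt n a \<in> cone n I"
    unfolding cone_def mem_Collect_eq using * by (intro exI conjI)
qed

lemma pow_diag_mat:
  "mat m m (\<lambda>(r, c). if r = c then d r else 0) ^\<^sub>m k =
   mat m m (\<lambda>(r, c). if r = c then (d r :: complex) ^ k else 0)"
proof (induction k)
  case 0 then show ?case by (intro eq_matI) auto
next
  case (Suc k)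
  then show ?case
    by (intro eq_matI)
      (auto simp: scalar_prod_def if_distrib[of "(*) _"] if_distrib[of "\<lambda>x. x * _"] cong: if_cong)
qed

lemma mat_exp_diag:
  "mat_exp (mat m m (\<lambda>(r, c). if r = c then d r else 0)) =
   mat m m (\<lambda>(r, c). if r = c then exp (d r) else 0)"
  by (intro eq_matI)
    (auto simp: mat_exp_def pow_diag_mat exp_def scaleR_conv_of_real divide_inverse mult.commute)

lemma cis_2pi_eq_1_iff: "cis (2 * pi * x) = 1 \<longleftrightarrow> x \<in> \<int>"
proof
  assume "cis (2 * pi * x) = 1"
  then have "cos (2 * pi * x) = 1" by (metis cis.sel(1) one_complex.sel(1))
  then obtain k :: int where "2 * pi * x = real_of_int k * 2 * pi" using cos_one_2pi_int by blast
  then show "x \<in> \<int>" by auto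
qed (auto simp: cis_multiple_2pi)

text \<open>
  The exponential of \<open>2\<pi>\<xi>\<close> is diagonal with entries \<open>exp (\<plusminus>2\<pi>\<i> a\<^sub>k)\<close>, each of which is 1 exactly when
  \<open>a\<^sub>k\<close> is an integer.
\<close>

lemma torus_elt_in_integral_lattice_iff:
  "torus_elt n a \<in> integral_lattice n \<longleftrightarrow> (\<forall>k\<in>{1..n}. a k \<in> \<int>)"
proof -
  have "mat_exp (complex_of_real (2 * pi) \<cdot>\<^sub>m torus_elt n a) =
      mat (2*n) (2*n) (\<lambda>(r, c). if r = c then cis (2 * pi * coord n r a) else 0)"
    unfolding torus_elt_smult
    by (simp only: torus_elt_def mat_exp_diag coord_scale) (auto simp: cis_conv_exp intro!: eq_matI)
  also have "\<dots> = 1\<^sub>m (2*n) \<longleftrightarrow> (\<forall>r<2*n. cis (2 * pi * coord n r a) = 1)"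
    by (auto simp: mat_eq_iff)
  also have "\<dots> \<longleftrightarrow> (\<forall>r<2*n. coord n r a \<in> \<int>)" by (simp add: cis_2pi_eq_1_iff)
  also have "\<dots> \<longleftrightarrow> (\<forall>k\<in>{1..n}. a k \<in> \<int>)"
  proof
    assume *: "\<forall>r<2*n. coord n r a \<in> \<int>"
    show "\<forall>k\<in>{1..n}. a k \<in> \<int>"
    proof
      fix k assume "k \<in> {1..n}"
      then obtain m where "k = m + 1" "m < n" by (cases k) auto
      then show "a k \<in> \<int>" using *[rule_format, of m] by (simp add: coord_def)
    qed
  qed (auto simp: coord_def)
  finally show ?thesis by (simp add: integral_lattice_def SO_2n_def torus_eq)
qed

lemma ball_positive_roots:
  "(\<forall>\<alpha>\<in>positive_roots n. P \<alpha>) \<longleftrightarrow>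
    (\<forall>i j. 1 \<le> i \<and> i < j \<and> j \<le> n \<longrightarrow> P (\<lambda>\<xi>. L i \<xi> + L j \<xi>) \<and> P (\<lambda>\<xi>. L i \<xi> - L j \<xi>))"
  unfolding positive_roots_def by blast

lemma torus_elt_in_dominant_lattice_iff:
  assumes "n \<ge> 2"
  shows "torus_elt n a \<in> dominant_lattice n \<longleftrightarrow>
    (\<forall>k\<in>{1..n}. a k \<in> \<int>) \<and> (\<forall>i\<in>{1..n}. 0 \<le> simple_coord n i a)"
proof -
  have pos: "(\<forall>\<alpha>\<in>positive_roots n. 0 \<le> \<alpha> (torus_elt n a) / \<i>) \<longleftrightarrow>
      (\<forall>i j. 1 \<le> i \<and> i < j \<and> j \<le> n \<longrightarrow> 0 \<le> a i + a j \<and> 0 \<le> a i - a j)" (is "?A \<longleftrightarrow> ?B")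
  proof -
    have "(0 \<le> (L i (torus_elt n a) + L j (torus_elt n a)) / \<i> \<longleftrightarrow> 0 \<le> a i + a j) \<and>
        (0 \<le> (L i (torus_elt n a) - L j (torus_elt n a)) / \<i> \<longleftrightarrow> 0 \<le> a i - a j)"
      if "1 \<le> i" "i < j" "j \<le> n" for i j
      using that by (auto simp: L_torus_elt less_eq_complex_def add_divide_distrib diff_divide_distrib)
    then show ?thesis unfolding ball_positive_roots by blast
  qed
  have "?B \<longleftrightarrow> (\<forall>i\<in>{1..n}. 0 \<le> simple_coord n i a)"
  proof
    assume B: ?B
    show "\<forall>i\<in>{1..n}. 0 \<le> simple_coord n i a"
    proof
      fix i assume "i \<in> {1..n}"
      then show "0 \<le> simple_coord n i a"
        using B[rule_format, of i "i + 1"] B[rule_format, of "n - 1" n] assms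
        by (auto simp: simple_coord_def)
    qed
  next
    assume *: "\<forall>i\<in>{1..n}. 0 \<le> simple_coord n i a"
    show ?B
    proof (intro allI impI)
      fix i j assume "1 \<le> i \<and> i < j \<and> j \<le> n"
      then have "simple_comb n (\<lambda>a. a i + a j)" "simple_comb n (\<lambda>a. a i - a j)"
        by (auto intro: simple_comb_sum simple_comb_diff)
      then show "0 \<le> a i + a j \<and> 0 \<le> a i - a j"
        using * simple_comb_nonneg[of n "\<lambda>a. a i + a j" a] simple_comb_nonneg[of n "\<lambda>a. a i - a j" a] by auto
    qed
  qed
  then show ?thesis
    by (simp only: dominant_lattice_def torus_elt_in_integral_lattice_iff pos mem_Collect_eq)
qed

section \<open>The Lie algebra entrywise\<close>

lemma gram_index: "r < 2*n \<Longrightarrow> c < 2*n \<Longrightarrow> gram n $$ (r, c) = of_bool (c = conj_index n r)"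
  by (auto simp: gram_def conj_index_def)

lemma gram_carrier [simp]: "gram n \<in> carrier_mat (2*n) (2*n)"
  and gram_dim [simp]: "dim_row (gram n) = 2*n" "dim_col (gram n) = 2*n"
  by (auto simp: gram_def)

lemma gram_mult_index:
  assumes "X \<in> carrier_mat (2*n) (2*n)" "r < 2*n" "c < 2*n"
  shows "(gram n * X) $$ (r, c) = X $$ (conj_index n r, c)"
proof -
  have "(gram n * X) $$ (r, c) = (\<Sum>k\<in>{0..<2*n}. of_bool (k = conj_index n r) * X $$ (k, c))"
    using assms by (auto simp: scalar_prod_def gram_index intro!: sum.cong)
  also have "\<dots> = (\<Sum>k\<in>{0..<2*n}. if k = conj_index n r then X $$ (k, c) else 0)"
    by (intro sum.cong) auto
  finally show ?thesis using assms by simp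
qed

lemma mult_gram_index:
  assumes "X \<in> carrier_mat (2*n) (2*n)" "r < 2*n" "c < 2*n"
  shows "(X * gram n) $$ (r, c) = X $$ (r, conj_index n c)"
proof -
  have "k < 2*n \<Longrightarrow> c = conj_index n k \<longleftrightarrow> k = conj_index n c" for k using assms by auto
  then have "(X * gram n) $$ (r, c) = (\<Sum>k\<in>{0..<2*n}. X $$ (r, k) * of_bool (k = conj_index n c))"
    using assms by (auto simp: scalar_prod_def gram_index intro!: sum.cong)
  also have "\<dots> = (\<Sum>k\<in>{0..<2*n}. if k = conj_index n c then X $$ (r, k) else 0)"
    by (intro sum.cong) auto
  finally show ?thesis using assms by simp
qed

text \<open>
  Infinitesimal \<open>Q\<close>-orthogonality, written as antisymmetry under the reflection of the matrix that
  fixes the positions \<open>(r, conj_index n r)\<close>. This is the complexified Lie algebra, seen entry by entry.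
\<close>

definition Q_skew :: "nat \<Rightarrow> complex mat \<Rightarrow> bool" where
  "Q_skew n X \<longleftrightarrow> X \<in> carrier_mat (2*n) (2*n) \<and>
    (\<forall>r<2*n. \<forall>c<2*n. X $$ (r, c) = - X $$ (conj_index n c, conj_index n r))"

lemma Q_skew_carrier: "Q_skew n X \<Longrightarrow> X \<in> carrier_mat (2*n) (2*n)"
  by (simp only: Q_skew_def)

lemma Q_skew_index:
  "Q_skew n X \<Longrightarrow> r < 2*n \<Longrightarrow> c < 2*n \<Longrightarrow> X $$ (conj_index n c, conj_index n r) = - X $$ (r, c)"
  unfolding Q_skew_def by (metis minus_minus)

lemma Q_skewI:
  assumes "X \<in> carrier_mat (2*n) (2*n)"
    "\<And>r c. r < 2*n \<Longrightarrow> c < 2*n \<Longrightarrow> X $$ (conj_index n c, conj_index n r) = - X $$ (r, c)"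
  shows "Q_skew n X"
  unfolding Q_skew_def using assms by (metis minus_minus)

lemma Q_skew_iff:
  assumes "X \<in> carrier_mat (2*n) (2*n)"
  shows "transpose_mat X * gram n + gram n * X = 0\<^sub>m (2*n) (2*n) \<longleftrightarrow> Q_skew n X"
proof -
  have "(transpose_mat X * gram n + gram n * X) $$ (r, c) =
      X $$ (conj_index n c, r) + X $$ (conj_index n r, c)" if "r < 2*n" "c < 2*n" for r c
    using that assms by (auto simp: mult_gram_index gram_mult_index simp del: index_mult_mat(1))
  then have "transpose_mat X * gram n + gram n * X = 0\<^sub>m (2*n) (2*n) \<longleftrightarrow>
      (\<forall>r<2*n. \<forall>c<2*n. X $$ (conj_index n c, r) + X $$ (conj_index n r, c) = 0)"
    using assms by (auto simp: mat_eq_iff simp del: index_mult_mat(1) index_add_mat(1))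
  also have "\<dots> \<longleftrightarrow> Q_skew n X"
  proof -
    have "(\<forall>r<2*n. \<forall>c<2*n. X $$ (conj_index n c, r) + X $$ (conj_index n r, c) = 0) \<longleftrightarrow>
      (\<forall>r<2*n. \<forall>c<2*n. X $$ (conj_index n c, conj_index n r) + X $$ (r, c) = 0)"
      by (metis conj_index_less conj_index_conj_index)
    then show ?thesis using assms by (auto simp: Q_skew_def eq_neg_iff_add_eq_0 add.commute)
  qed
  finally show ?thesis .
qed

lemma so_2n_iff:
  "A \<in> so_2n n \<longleftrightarrow> Q_skew n A \<and>
    (\<forall>r<2*n. \<forall>c<2*n. cnj (A $$ (conj_index n r, conj_index n c)) = A $$ (r, c))"
proof (cases "A \<in> carrier_mat (2*n) (2*n)")
  case True
  have "(gram n * map_mat cnj A * gram n) $$ (r, c) = cnj (A $$ (conj_index n r, conj_index n c))"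
    if "r < 2*n" "c < 2*n" for r c
  proof -
    have C: "map_mat cnj A \<in> carrier_mat (2*n) (2*n)" using True by auto
    have "(gram n * map_mat cnj A * gram n) $$ (r, c) = (gram n * map_mat cnj A) $$ (r, conj_index n c)"
      using that C by (intro mult_gram_index) auto
    also have "\<dots> = map_mat cnj A $$ (conj_index n r, conj_index n c)"
      using that C by (intro gram_mult_index) auto
    finally show ?thesis using that True by simp
  qed
  then have "gram n * map_mat cnj A * gram n = A \<longleftrightarrow>
      (\<forall>r<2*n. \<forall>c<2*n. cnj (A $$ (conj_index n r, conj_index n c)) = A $$ (r, c))"
    using True by (auto simp: mat_eq_iff simp del: index_mult_mat(1))
  then show ?thesis using True by (auto simp: so_2n_def Q_skew_iff)
next
  case False then show ?thesis by (auto simp: so_2n_def Q_skew_def)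
qed

text \<open>
  The inclusion of the \<open>Q\<close>-skew matrices in the complexification is the splitting of \<open>X\<close> into
  real and imaginary part, \<open>Y\<close> being the conjugate of \<open>X\<close> with respect to the real form.
\<close>

lemma carrier_so_2n_C: "carrier (so_2n_C n) = Collect (Q_skew n)"
proof (intro equalityI subsetI)
  fix X assume "X \<in> carrier (so_2n_C n)"
  then obtain A B where X: "X = A + \<i> \<cdot>\<^sub>m B" and "A \<in> so_2n n" "B \<in> so_2n n"
    by (auto simp: so_2n_C_def)
  then have AB: "Q_skew n A" "Q_skew n B" by (auto simp: so_2n_iff)
  note car = Q_skew_carrier[OF AB(1)] Q_skew_carrier[OF AB(2)]
  have "Q_skew n X"
  proof (rule Q_skewI)
    show "X \<in> carrier_mat (2*n) (2*n)" using car X by auto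
    fix r c assume rc: "r < 2*n" "c < 2*n"
    have i: "X $$ (r, c) = A $$ (r, c) + \<i> * B $$ (r, c)" if "r < 2*n" "c < 2*n" for r c
      using that car X by auto
    show "X $$ (conj_index n c, conj_index n r) = - X $$ (r, c)"
      using rc AB by (simp add: i Q_skew_index)
  qed
  then show "X \<in> Collect (Q_skew n)" by simp
next
  fix X assume "X \<in> Collect (Q_skew n)"
  then have X: "Q_skew n X" by simp
  note C = Q_skew_carrier[OF X] and S = Q_skew_index[OF X]
  define Y where "Y = mat (2*n) (2*n) (\<lambda>(r, c). cnj (X $$ (conj_index n r, conj_index n c)))"
  define A where "A = (1/2) \<cdot>\<^sub>m (X + Y)"
  define B where "B = (- \<i> / 2) \<cdot>\<^sub>m (X - Y)"
  have A: "A $$ (r, c) = (X $$ (r, c) + cnj (X $$ (conj_index n r, conj_index n c))) / 2"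
    and B: "B $$ (r, c) = (- \<i> / 2) * (X $$ (r, c) - cnj (X $$ (conj_index n r, conj_index n c)))"
    if "r < 2*n" "c < 2*n" for r c using that C by (auto simp: A_def B_def Y_def)
  have car: "A \<in> carrier_mat (2*n) (2*n)" "B \<in> carrier_mat (2*n) (2*n)"
    using C by (auto simp: A_def B_def Y_def)
  have "Q_skew n A" "Q_skew n B"
    using car by (auto intro!: Q_skewI simp: A B S ring_distribs add_divide_distrib diff_divide_distrib)
  moreover have "cnj (A $$ (conj_index n r, conj_index n c)) = A $$ (r, c)"
    "cnj (B $$ (conj_index n r, conj_index n c)) = B $$ (r, c)" if "r < 2*n" "c < 2*n" for r c
    using that by (simp_all add: A B ring_distribs)
  ultimately have "A \<in> so_2n n" "B \<in> so_2n n"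
    by (simp_all add: so_2n_iff)
  moreover have "X = A + \<i> \<cdot>\<^sub>m B"
  proof (rule eq_matI)
    fix r c assume "r < dim_row (A + \<i> \<cdot>\<^sub>m B)" "c < dim_col (A + \<i> \<cdot>\<^sub>m B)"
    then have rc: "r < 2*n" "c < 2*n" using car by auto
    then have "(A + \<i> \<cdot>\<^sub>m B) $$ (r, c) = A $$ (r, c) + \<i> * B $$ (r, c)" using car by simp
    also have "\<dots> = X $$ (r, c)" using rc by (simp add: A B complex_eq_iff field_simps)
    finally show "X $$ (r, c) = (A + \<i> \<cdot>\<^sub>m B) $$ (r, c)" by simp
  qed (use C car in auto)
  ultimately show "X \<in> carrier (so_2n_C n)" by (auto simp: so_2n_C_def)
qed

lemma so_2n_C_simps:
  "add (so_2n_C n) = (+)" "zero (so_2n_C n) = 0\<^sub>m (2*n) (2*n)" "module.smult (so_2n_C n) = (\<cdot>\<^sub>m)"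
  by (simp_all add: so_2n_C_def module_mat_def)

lemma Q_skew_zero: "Q_skew n (0\<^sub>m (2*n) (2*n))"
  by (rule Q_skewI) auto

lemma Q_skew_add: "Q_skew n X \<Longrightarrow> Q_skew n Y \<Longrightarrow> Q_skew n (X + Y)"
  using Q_skew_carrier[of n X] Q_skew_carrier[of n Y]
  by (intro Q_skewI) (auto simp: Q_skew_index)

lemma abelian_monoid_so_2n_C: "abelian_monoid (so_2n_C n)"
proof (rule abelian_monoidI)
  fix x y z assume "x \<in> carrier (so_2n_C n)" "y \<in> carrier (so_2n_C n)" "z \<in> carrier (so_2n_C n)"
  then have C: "x \<in> carrier_mat (2*n) (2*n)" "y \<in> carrier_mat (2*n) (2*n)" "z \<in> carrier_mat (2*n) (2*n)"
    by (auto simp: carrier_so_2n_C Q_skew_carrier)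
  show "x \<oplus>\<^bsub>so_2n_C n\<^esub> y \<oplus>\<^bsub>so_2n_C n\<^esub> z = x \<oplus>\<^bsub>so_2n_C n\<^esub> (y \<oplus>\<^bsub>so_2n_C n\<^esub> z)"
    using C by (simp add: so_2n_C_simps)
next
  fix x y assume "x \<in> carrier (so_2n_C n)" "y \<in> carrier (so_2n_C n)"
  then have C: "x \<in> carrier_mat (2*n) (2*n)" "y \<in> carrier_mat (2*n) (2*n)"
    by (auto simp: carrier_so_2n_C Q_skew_carrier)
  show "x \<oplus>\<^bsub>so_2n_C n\<^esub> y = y \<oplus>\<^bsub>so_2n_C n\<^esub> x"
    using C by (simp add: so_2n_C_simps comm_add_mat)
qed (auto simp: so_2n_C_simps carrier_so_2n_C Q_skew_zero Q_skew_add dest!: Q_skew_carrier)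

lemma finsum_so_2n_C_index:
  assumes "finite J" "\<And>j. j \<in> J \<Longrightarrow> Q_skew n (X j)"
  shows "Q_skew n (finsum (so_2n_C n) X J) \<and>
    (\<forall>r<2*n. \<forall>c<2*n. finsum (so_2n_C n) X J $$ (r, c) = (\<Sum>j\<in>J. X j $$ (r, c)))"
  using assms
proof (induction J rule: finite_induct)
  case empty
  interpret abelian_monoid "so_2n_C n" by (rule abelian_monoid_so_2n_C)
  show ?case by (simp add: so_2n_C_simps Q_skew_zero)
next
  case (insert i J)
  interpret M: abelian_monoid "so_2n_C n" by (rule abelian_monoid_so_2n_C)
  let ?S = "finsum (so_2n_C n) X J"
  have ins: "finsum (so_2n_C n) X (insert i J) = X i + ?S"
    using insert by (subst M.finsum_insert) (auto simp: so_2n_C_simps carrier_so_2n_C)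
  have S: "Q_skew n ?S" "\<forall>r<2*n. \<forall>c<2*n. ?S $$ (r, c) = (\<Sum>j\<in>J. X j $$ (r, c))"
    using insert by auto
  have "Q_skew n (X i)" using insert.prems by simp
  with S(1) have "Q_skew n (X i + ?S)" by (intro Q_skew_add)
  moreover have "(X i + ?S) $$ (r, c) = (\<Sum>j\<in>insert i J. X j $$ (r, c))" if "r < 2*n" "c < 2*n" for r c
    using Q_skew_carrier[OF S(1)] S(2) insert.hyps that by simp
  ultimately show ?case unfolding ins by blast
qed

text \<open>
  A torus element acts diagonally: the entry \<open>(r, c)\<close> is a weight vector.
\<close>

lemma ad_torus_elt:
  assumes "X \<in> carrier_mat (2*n) (2*n)"
  shows "ad (torus_elt n a) X \<in> carrier_mat (2*n) (2*n)"
    and "r < 2*n \<Longrightarrow> c < 2*n \<Longrightarrow>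
      ad (torus_elt n a) X $$ (r, c) = \<i> * of_real (coord n r a - coord n c a) * X $$ (r, c)"
proof -
  show "ad (torus_elt n a) X \<in> carrier_mat (2*n) (2*n)" unfolding ad_def using assms
    by (intro minus_carrier_mat mult_carrier_mat[of _ "2*n" "2*n"]) simp_all
  assume rc: "r < 2*n" "c < 2*n"
  have "(torus_elt n a * X) $$ (r, c) = (\<Sum>k\<in>{0..<2*n}. (if r = k then \<i> * of_real (coord n r a) else 0) * X $$ (k, c))"
    using assms rc by (auto simp: scalar_prod_def torus_elt_index intro!: sum.cong)
  also have "\<dots> = \<i> * of_real (coord n r a) * X $$ (r, c)"
    using rc by (simp add: if_distrib[of "\<lambda>x. x * _"] cong: if_cong)
  finally have 1: "(torus_elt n a * X) $$ (r, c) = \<i> * of_real (coord n r a) * X $$ (r, c)" .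
  have "(X * torus_elt n a) $$ (r, c) = (\<Sum>k\<in>{0..<2*n}. X $$ (r, k) * (if k = c then \<i> * of_real (coord n k a) else 0))"
    using assms rc by (auto simp: scalar_prod_def torus_elt_index intro!: sum.cong)
  also have "\<dots> = \<i> * of_real (coord n c a) * X $$ (r, c)"
    using rc by (simp add: if_distrib[of "(*) _"] cong: if_cong)
  finally have "(X * torus_elt n a) $$ (r, c) = \<i> * of_real (coord n c a) * X $$ (r, c)" .
  with 1 show "ad (torus_elt n a) X $$ (r, c) = \<i> * of_real (coord n r a - coord n c a) * X $$ (r, c)"
    using assms rc by (simp add: ad_def algebra_simps del: index_mult_mat(1))
qed

lemma eigenspace_ad_torus_elt:
  "X \<in> eigenspace_ad n (torus_elt n a) j \<longleftrightarrow> Q_skew n X \<and>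
    (\<forall>r<2*n. \<forall>c<2*n. X $$ (r, c) \<noteq> 0 \<longrightarrow> coord n r a - coord n c a = of_int j)"
proof (cases "Q_skew n X")
  case True
  note C = Q_skew_carrier[OF True]
  have "ad (torus_elt n a) X = (\<i> * of_int j) \<cdot>\<^sub>m X \<longleftrightarrow>
      (\<forall>r<2*n. \<forall>c<2*n. \<i> * of_real (coord n r a - coord n c a) * X $$ (r, c) = \<i> * of_int j * X $$ (r, c))"
    using C ad_torus_elt(1)[OF C, of a] ad_torus_elt(2)[OF C, of _ _ a] by (auto simp: mat_eq_iff)
  moreover have "\<i> * of_real (coord n r a - coord n c a) * X $$ (r, c) = \<i> * of_int j * X $$ (r, c) \<longleftrightarrow>
     X $$ (r, c) = 0 \<or> coord n r a - coord n c a = of_int j" for r c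
    by (metis complex_i_not_zero mult_cancel_left mult_cancel_right of_real_eq_iff of_real_of_int_eq)
  ultimately show ?thesis using True by (auto simp: eigenspace_ad_def carrier_so_2n_C)
qed (auto simp: eigenspace_ad_def carrier_so_2n_C)

text \<open>
  Grouping the entries of \<open>X\<close> by their \<open>ad \<xi>\<close>-eigenvalue decomposes \<open>X\<close> into eigenvectors. The
  components stay in the Lie algebra because the two entries exchanged by the symmetry of a
  \<open>Q\<close>-skew matrix have the same eigenvalue. Integrality of \<open>\<xi>\<close> makes all eigenvalues of the form
  \<open>\<i> j\<close> with \<open>j\<close> an integer.
\<close>

lemma parabolic_torus_elt:
  assumes "\<forall>k\<in>{1..n}. a k \<in> \<int>"
  shows "X \<in> parabolic n (torus_elt n a) i \<longleftrightarrow> Q_skew n X \<and>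
    (\<forall>r<2*n. \<forall>c<2*n. X $$ (r, c) \<noteq> 0 \<longrightarrow> coord n r a - coord n c a \<le> of_int i)"
proof
  assume "X \<in> parabolic n (torus_elt n a) i"
  then obtain Y J where X: "X = finsum (so_2n_C n) Y J" and J: "finite J" "J \<subseteq> {..i}"
    and "Y \<in> (\<Pi> j \<in> J. eigenspace_ad n (torus_elt n a) j)"
    unfolding parabolic_def by blast
  then have Y: "\<And>j. j \<in> J \<Longrightarrow> Y j \<in> eigenspace_ad n (torus_elt n a) j" by auto
  then have S: "\<And>j. j \<in> J \<Longrightarrow> Q_skew n (Y j)" by (simp add: eigenspace_ad_torus_elt)
  note I = finsum_so_2n_C_index[of J n Y, OF J(1) S, folded X]
  show "Q_skew n X \<and>
    (\<forall>r<2*n. \<forall>c<2*n. X $$ (r, c) \<noteq> 0 \<longrightarrow> coord n r a - coord n c a \<le> of_int i)"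
  proof (intro conjI allI impI)
    show "Q_skew n X" using I by blast
    fix r c assume rc: "r < 2*n" "c < 2*n" "X $$ (r, c) \<noteq> 0"
    then have "(\<Sum>j\<in>J. Y j $$ (r, c)) \<noteq> 0" using I by auto
    then obtain j where j: "j \<in> J" "Y j $$ (r, c) \<noteq> 0" by (metis sum.neutral)
    then have "coord n r a - coord n c a = of_int j" using Y rc by (auto simp: eigenspace_ad_torus_elt)
    then show "coord n r a - coord n c a \<le> of_int i" using j J by auto
  qed
next
  assume *: "Q_skew n X \<and>
    (\<forall>r<2*n. \<forall>c<2*n. X $$ (r, c) \<noteq> 0 \<longrightarrow> coord n r a - coord n c a \<le> of_int i)"
  then have X: "Q_skew n X" by simp
  note C = Q_skew_carrier[OF X]
  define d where "d r c = \<lfloor>coord n r a - coord n c a\<rfloor>" for r c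
  have ints: "coord n r a \<in> \<int>" if "r < 2*n" for r
    using assms that by (auto simp: coord_def)
  then have d: "of_int (d r c) = coord n r a - coord n c a" if "r < 2*n" "c < 2*n" for r c
    unfolding d_def using that by (metis Ints_diff Ints_cases floor_of_int)
  define Y where "Y j = mat (2*n) (2*n) (\<lambda>(r, c). if d r c = j then X $$ (r, c) else 0)" for j
  define J where "J = (\<lambda>(r, c). d r c) ` ({..<2*n} \<times> {..<2*n}) \<inter> {..i}"
  have J: "finite J" "J \<subseteq> {..i}" by (auto simp: J_def)
  have dconj: "d (conj_index n c) (conj_index n r) = d r c" if "r < 2*n" "c < 2*n" for r c
    using that by (simp add: d_def)
  have S: "Q_skew n (Y j)" for j
    by (rule Q_skewI) (auto simp: Y_def dconj Q_skew_index[OF X])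
  have E: "Y j \<in> eigenspace_ad n (torus_elt n a) j" for j
    unfolding eigenspace_ad_torus_elt using S by (auto simp: Y_def d[symmetric])
  note I = finsum_so_2n_C_index[of J n Y, OF J(1) S]
  have "X = finsum (so_2n_C n) Y J"
  proof (rule eq_matI)
    have fC: "finsum (so_2n_C n) Y J \<in> carrier_mat (2*n) (2*n)" using I Q_skew_carrier by blast
    show "dim_row X = dim_row (finsum (so_2n_C n) Y J)" "dim_col X = dim_col (finsum (so_2n_C n) Y J)"
      using C fC by auto
    fix r c assume "r < dim_row (finsum (so_2n_C n) Y J)" "c < dim_col (finsum (so_2n_C n) Y J)"
    then have rc: "r < 2*n" "c < 2*n" using fC by auto
    have "d r c \<in> J \<or> X $$ (r, c) = 0"
    proof (rule disjCI)
      assume "X $$ (r, c) \<noteq> 0"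
      then have "real_of_int (d r c) \<le> real_of_int i" using * rc d by auto
      then show "d r c \<in> J" unfolding J_def using rc by auto
    qed
    moreover have "finsum (so_2n_C n) Y J $$ (r, c) = (\<Sum>j\<in>J. if d r c = j then X $$ (r, c) else 0)"
      using I rc by (simp add: Y_def)
    ultimately show "X $$ (r, c) = finsum (so_2n_C n) Y J $$ (r, c)" using J by auto
  qed
  moreover have "Y \<in> (\<Pi> j \<in> J. eigenspace_ad n (torus_elt n a) j)" using E by auto
  ultimately show "X \<in> parabolic n (torus_elt n a) i"
    unfolding parabolic_def mem_Collect_eq using J by (intro exI conjI)
qed

text \<open>
  The matrix unit at \<open>(p, q)\<close> made \<open>Q\<close>-skew. It is zero when \<open>p\<close> and \<open>q\<close> are conjugate; otherwise it is
  a weight vector for the weight of the entry \<open>(p, q)\<close>, which is a root if \<open>p \<noteq> q\<close>.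
\<close>

definition root_vec :: "nat \<Rightarrow> nat \<Rightarrow> nat \<Rightarrow> complex mat" where
  "root_vec n p q = mat (2*n) (2*n) (\<lambda>(r, c).
     of_bool (r = p \<and> c = q) - of_bool (r = conj_index n q \<and> c = conj_index n p))"

lemma Q_skew_root_vec:
  assumes "p < 2*n" "q < 2*n"
  shows "Q_skew n (root_vec n p q)"
proof (rule Q_skewI)
  fix r c assume rc: "r < 2*n" "c < 2*n"
  then have "conj_index n c = p \<longleftrightarrow> c = conj_index n p" "conj_index n r = q \<longleftrightarrow> r = conj_index n q"
    "conj_index n c = conj_index n q \<longleftrightarrow> c = q" "conj_index n r = conj_index n p \<longleftrightarrow> r = p"
    using assms by (metis conj_index_conj_index)+
  then show "root_vec n p q $$ (conj_index n c, conj_index n r) = - root_vec n p q $$ (r, c)"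
    using rc by (simp add: root_vec_def conj_commute)
qed (auto simp: root_vec_def)

lemma root_vec_coord:
  assumes "p < 2*n" "q < 2*n" "r < 2*n" "c < 2*n" "root_vec n p q $$ (r, c) \<noteq> 0"
  shows "coord n r a - coord n c a = coord n p a - coord n q a"
  using assms by (auto simp: root_vec_def of_bool_def split: if_splits)

lemma root_vec_index:
  "p < 2*n \<Longrightarrow> q < 2*n \<Longrightarrow> p \<noteq> conj_index n q \<Longrightarrow> root_vec n p q $$ (p, q) = 1"
  by (auto simp: root_vec_def)

text \<open>
  The symmetry maps an entry \<open>(r, conj_index n r)\<close> to itself with the opposite sign, so
  \<open>\<plusminus>2 L\<^sub>i\<close> is not a root.
\<close>

lemma Q_skew_nonzero_index:
  assumes "Q_skew n X" "r < 2*n" "c < 2*n" "X $$ (r, c) \<noteq> 0"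
  shows "r \<noteq> conj_index n c"
  using Q_skew_index[OF assms(1-3)] assms by auto

section \<open>The order on the dominant lattice\<close>

text \<open>
  Lowering the coefficients of an element makes its parabolics larger. The weight of a
  nonzero entry is a positive root, whose value on \<open>b\<close> is no larger than on \<open>a\<close>, or a negative root
  or zero, whose value on the dominant \<open>b\<close> is at most \<open>0 \<le> i\<close>. The second case is where the definition of the
  order uses only nonnegative levels.
\<close>

lemma preceq_torus_eltI:
  assumes "\<forall>k\<in>{1..n}. a k \<in> \<int>" "\<forall>k\<in>{1..n}. b k \<in> \<int>"
    and "\<And>i. i \<in> {1..n} \<Longrightarrow> 0 \<le> simple_coord n i b"
    and "\<And>i. i \<in> {1..n} \<Longrightarrow> simple_coord n i b \<le> simple_coord n i a"
  shows "preceq n (torus_elt n a) (torus_elt n b)"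
  unfolding preceq_def
proof (intro allI impI subsetI)
  fix i :: int and X assume i: "0 \<le> i" and "X \<in> parabolic n (torus_elt n a) i"
  then have X: "Q_skew n X"
    and le: "\<And>r c. r < 2*n \<Longrightarrow> c < 2*n \<Longrightarrow> X $$ (r, c) \<noteq> 0 \<Longrightarrow> coord n r a - coord n c a \<le> of_int i"
    using assms by (auto simp: parabolic_torus_elt)
  have "coord n r b - coord n c b \<le> of_int i" if rc: "r < 2*n" "c < 2*n" "X $$ (r, c) \<noteq> 0" for r c
    using root_positive_or_negative[OF rc(1,2) Q_skew_nonzero_index[OF X rc]]
  proof
    assume "simple_comb n (\<lambda>a. coord n r a - coord n c a)"
    then have "coord n r b - coord n c b \<le> coord n r a - coord n c a"
      using assms(4) by (rule simple_comb_mono)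
    then show ?thesis using le[OF rc] by simp
  next
    assume "simple_comb n (\<lambda>a. coord n c a - coord n r a)"
    then have "0 \<le> coord n c b - coord n r b"
      using assms(3) by (rule simple_comb_nonneg)
    then show ?thesis using i by (smt (verit) of_int_0_le_iff)
  qed
  then show "X \<in> parabolic n (torus_elt n b) i"
    using X assms by (auto simp: parabolic_torus_elt)
qed

lemma simple_coord_eq_coord_diff:
  assumes "n \<ge> 2" "i \<in> {1..n}"
  obtains p q where "p < 2*n" "q < 2*n" "p \<noteq> conj_index n q"
    "\<And>a. simple_coord n i a = coord n p a - coord n q a"
proof (cases "i < n")
  case True
  show ?thesis
  proof (rule that[of "i - 1" i])
    show "simple_coord n i a = coord n (i - 1) a - coord n i a" for a
      using True assms by (cases i) (simp_all add: simple_coord_def coord_def)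
  qed (use True assms in \<open>auto simp: conj_index_def\<close>)
next
  case False
  show ?thesis
  \<comment> \<open>The entry of \<open>\<alpha>\<^sub>n = L\<^sub>n\<^sub>-\<^sub>1 + L\<^sub>n\<close>: index \<open>n - 2\<close> carries \<open>L\<^sub>n\<^sub>-\<^sub>1\<close> and index \<open>2n - 1\<close> carries \<open>-L\<^sub>n\<close>.\<close>
  proof (rule that[of "n - 2" "2*n - 1"])
    have "n - 2 + 1 = n - 1" "2*n - 1 - n + 1 = n" using assms by auto
    then show "simple_coord n i a = coord n (n - 2) a - coord n (2*n - 1) a" for a
      using False assms by (auto simp: simple_coord_def coord_def)
  qed (use assms in \<open>auto simp: conj_index_def\<close>)
qed

text \<open>
  The converse is tested on the root vector of the simple root \<open>\<alpha>\<^sub>i\<close>: it lies in the parabolic of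
  level \<open>m = \<alpha>\<^sub>i(a) / \<i>\<close> for \<open>a\<close>, and lying in the one for \<open>b\<close> says that \<open>\<alpha>\<^sub>i(b) / \<i>\<close> is at most \<open>m\<close>.
\<close>

lemma preceq_torus_eltD:
  assumes "n \<ge> 2" "\<forall>k\<in>{1..n}. a k \<in> \<int>" "\<forall>k\<in>{1..n}. b k \<in> \<int>"
    and "preceq n (torus_elt n a) (torus_elt n b)"
    and "i \<in> {1..n}" "0 \<le> simple_coord n i a"
  shows "simple_coord n i b \<le> simple_coord n i a"
proof -
  obtain p q where pq: "p < 2*n" "q < 2*n" "p \<noteq> conj_index n q"
    and s: "\<And>a. simple_coord n i a = coord n p a - coord n q a"
    using simple_coord_eq_coord_diff assms(1,5) by metis
  have "simple_coord n i a \<in> \<int>" using assms(1,2,5) by (auto simp: simple_coord_def)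
  then obtain m where m: "simple_coord n i a = of_int m" by (auto elim: Ints_cases)
  have "root_vec n p q \<in> parabolic n (torus_elt n a) m"
    using assms(2) pq by (simp add: parabolic_torus_elt Q_skew_root_vec root_vec_coord flip: s m)
  then have "root_vec n p q \<in> parabolic n (torus_elt n b) m"
    using assms(4,6) m by (auto simp: preceq_def)
  then have "coord n p b - coord n q b \<le> of_int m"
    using assms(3) pq root_vec_index[OF pq] by (auto simp: parabolic_torus_elt)
  then show ?thesis by (simp add: s m flip: m)
qed

section \<open>The canonical element\<close>

lemma simple_coord_last_sum:
  "n \<ge> 2 \<Longrightarrow> simple_coord n (n - 1) a + simple_coord n n a = 2 * a (n - 1)"
  by (simp add: simple_coord_def)

text \<open>
  The parity condition that distinguishes \<open>SO(2n)\<close> from the adjoint group: half the sum of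
  the coefficients at \<open>H\<^sub>n\<^sub>-\<^sub>1\<close> and \<open>H\<^sub>n\<close> is the coordinate \<open>a\<^sub>n\<^sub>-\<^sub>1\<close>.
\<close>

lemma integral_coords_iff:
  assumes "n \<ge> 2"
  shows "(\<forall>k\<in>{1..n}. a k \<in> \<int>) \<longleftrightarrow>
    (\<forall>j\<in>{1..n}. simple_coord n j a \<in> \<int>) \<and> (simple_coord n (n - 1) a + simple_coord n n a) / 2 \<in> \<int>"
proof
  assume "\<forall>k\<in>{1..n}. a k \<in> \<int>"
  then show "(\<forall>j\<in>{1..n}. simple_coord n j a \<in> \<int>) \<and>
      (simple_coord n (n - 1) a + simple_coord n n a) / 2 \<in> \<int>"
    using assms unfolding simple_coord_last_sum[OF assms] by (auto simp: simple_coord_def)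
next
  assume *: "(\<forall>j\<in>{1..n}. simple_coord n j a \<in> \<int>) \<and>
      (simple_coord n (n - 1) a + simple_coord n n a) / 2 \<in> \<int>"
  have penultimate: "a (n - 1) \<in> \<int>" using * unfolding simple_coord_last_sum[OF assms] by simp
  have "simple_coord n n a - a (n - 1) \<in> \<int>" using * penultimate assms by (intro Ints_diff) auto
  then have last: "a n \<in> \<int>" by (simp add: simple_coord_def)
  show "\<forall>k\<in>{1..n}. a k \<in> \<int>"
  proof
    fix k assume "k \<in> {1..n}"
    then have "k \<le> n" "1 \<le> k" by auto
    then show "a k \<in> \<int>"
    proof (induction rule: inc_induct)
      case base show ?case by (rule last)
    next
      case (step m)
      then have "simple_coord n m a + a (Suc m) \<in> \<int>" using * by (intro Ints_add) auto
      then show ?case using step by (simp add: simple_coord_def)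
    qed
  qed
qed

lemma eps_0_or_1: "eps n I = 0 \<or> eps n I = 1"
  by (simp add: eps_def)

lemma candidate_coords:
  assumes "n \<ge> 2" "I \<subseteq> {1..n}" "eps n I = 1 \<Longrightarrow> s \<in> {n-1, n} \<inter> I"
  obtains a where "xi n I + of_nat (eps n I) \<cdot>\<^sub>m H n s = torus_elt n a"
    "\<And>j. j \<in> {1..n} \<Longrightarrow> simple_coord n j a = of_bool (j \<in> I) + real (eps n I) * of_bool (j = s)"
proof
  let ?b = "\<lambda>k. \<Sum>j\<in>I. 1 * H_coord n j k" and ?h = "\<lambda>k. real (eps n I) * H_coord n s k"
  have fin: "finite I" using assms(2) finite_subset by blast
  have "xi n I = torus_elt n ?b"
    unfolding xi_def using fin assms by (intro lincomb_2n_torus_elt) (auto simp: H_eq_torus_elt)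
  moreover have "of_nat (eps n I) \<cdot>\<^sub>m H n s = torus_elt n ?h"
    using torus_elt_smult[of "real (eps n I)" n "H_coord n s"] assms(1) by (simp add: H_eq_torus_elt)
  ultimately show "xi n I + of_nat (eps n I) \<cdot>\<^sub>m H n s = torus_elt n (\<lambda>k. ?b k + ?h k)"
    by (simp only: torus_elt_add)
  fix j assume j: "j \<in> {1..n}"
  have "simple_coord n j (\<lambda>k. ?b k + ?h k) =
      (\<Sum>i\<in>I. simple_coord n j (H_coord n i)) + real (eps n I) * simple_coord n j (H_coord n s)"
    by (auto simp: simple_coord_def sum_subtractf sum.distrib algebra_simps)
  also have "(\<Sum>i\<in>I. simple_coord n j (H_coord n i)) = (\<Sum>i\<in>I. of_bool (j = i))"
    using assms j by (intro sum.cong) (auto simp: simple_coord_H_coord)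
  also have "\<dots> = of_bool (j \<in> I)" using fin by (simp add: of_bool_def)
  also have "real (eps n I) * simple_coord n j (H_coord n s) = real (eps n I) * of_bool (j = s)"
    using eps_0_or_1[of n I]
  proof (elim disjE)
    assume "eps n I = 1"
    then have "s \<in> {1..n}" using assms by auto
    then show ?thesis using assms(1) j by (simp add: simple_coord_H_coord)
  qed simp
  finally show "simple_coord n j (\<lambda>k. ?b k + ?h k) = of_bool (j \<in> I) + real (eps n I) * of_bool (j = s)" .
qed

lemma eps_cases:
  assumes "n \<ge> 2"
  shows "eps n I = of_bool ((n - 1 \<in> I) \<noteq> (n \<in> I))"
proof -
  have "n - 1 \<noteq> n" using assms by auto
  then show ?thesis by (cases "n - 1 \<in> I"; cases "n \<in> I") (simp_all add: eps_def Int_insert_right)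
qed

text \<open>
  The element \<open>\<xi>\<^sub>I + \<epsilon> H\<^sub>s\<close>, through the values of the simple roots on it: 1 on \<open>I\<close> and 0 off \<open>I\<close>,
  except that the value at \<open>s\<close> is 2 when \<open>\<epsilon> = 1\<close>.
\<close>

locale candidate =
  fixes n s :: nat and I :: "nat set" and a0 :: "nat \<Rightarrow> real"
  assumes n: "n \<ge> 2" and I: "I \<subseteq> {1..n}" and s: "eps n I = 1 \<Longrightarrow> s \<in> {n-1, n} \<inter> I"
    and c0: "\<And>j. j \<in> {1..n} \<Longrightarrow> simple_coord n j a0 = of_bool (j \<in> I) + real (eps n I) * of_bool (j = s)"
begin

lemma last_sum: "simple_coord n (n - 1) a0 + simple_coord n n a0 = 2 * of_bool (n - 1 \<in> I \<or> n \<in> I)"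
proof -
  have "n - 1 \<in> {1..n}" "n \<in> {1..n}" and ne: "n - 1 \<noteq> n" using n by auto
  note c = c0[OF this(1)] c0[OF this(2)]
  show ?thesis
  proof (cases "(n - 1 \<in> I) = (n \<in> I)")
    case True
    then show ?thesis unfolding c by (simp add: eps_cases[OF n])
  next
    case False
    then have e: "eps n I = 1" by (simp add: eps_cases[OF n])
    with s False have "(n - 1 \<in> I \<and> n \<notin> I \<and> s = n - 1) \<or> (n \<in> I \<and> n - 1 \<notin> I \<and> s = n)" by blast
    then show ?thesis using ne unfolding c e by (elim disjE) simp_all
  qed
qed

lemma integral: "\<forall>k\<in>{1..n}. a0 k \<in> \<int>"
  by (rule integral_coords_iff[OF n, THEN iffD2]) (simp only: last_sum, auto simp: c0)

lemma nonneg: "j \<in> {1..n} \<Longrightarrow> 0 \<le> simple_coord n j a0"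
  by (simp add: c0)

lemma zero_iff:
  assumes "j \<in> {1..n}"
  shows "simple_coord n j a0 = 0 \<longleftrightarrow> j \<notin> I"
  using eps_0_or_1[of n I]
proof (elim disjE)
  assume "eps n I = 1"
  then have "eps n I = 1" "s \<in> I" using s by blast+
  then show ?thesis using assms by (auto simp: c0)
qed (use assms in \<open>simp add: c0\<close>)

lemma simple_coord_eq_1:
  assumes "j \<in> {1..n}" "j \<in> I" "eps n I = 0 \<or> j \<noteq> s"
  shows "simple_coord n j a0 = 1"
  using assms by (auto simp: c0)

lemma mem: "torus_elt n a0 \<in> dominant_lattice n \<inter> cone n I"
  using integral nonneg zero_iff
  by (simp add: torus_elt_in_dominant_lattice_iff[OF n] torus_elt_in_cone_iff[OF n])

text \<open>
  Coefficients of elements of the set are integers, positive on \<open>I\<close>, which gives the bound at every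
  index where the candidate takes the value 0 or 1. When \<open>I\<close> contains exactly one of \<open>n - 1\<close> and
  \<open>n\<close>, the other coefficient vanishes and the parity condition forces the remaining one to be even,
  hence at least 2.
\<close>

lemma least:
  assumes "torus_elt n a \<in> dominant_lattice n \<inter> cone n I" "j \<in> {1..n}"
  shows "simple_coord n j a0 \<le> simple_coord n j a"
proof -
  have "\<forall>k\<in>{1..n}. a k \<in> \<int>"
    using assms(1) unfolding torus_elt_in_dominant_lattice_iff[OF n] Int_iff by blast
  then have "(\<forall>j\<in>{1..n}. simple_coord n j a \<in> \<int>) \<and>
      (simple_coord n (n - 1) a + simple_coord n n a) / 2 \<in> \<int>"
    by (rule integral_coords_iff[OF n, THEN iffD1])
  note int = bspec[OF conjunct1[OF this]] and half = conjunct2[OF this]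
  have "\<forall>j\<in>{1..n}. simple_coord n j a \<ge> 0 \<and> (simple_coord n j a = 0 \<longleftrightarrow> j \<notin> I)"
    using assms(1) unfolding torus_elt_in_cone_iff[OF n] Int_iff by (rule conjunct2)
  note nn = conjunct1[OF bspec[OF this]] and zero = conjunct2[OF bspec[OF this]]
  have pos: "1 \<le> x" if "x \<in> \<int>" "0 \<le> x" "x \<noteq> 0" for x :: real
    using that by (auto elim!: Ints_cases)
  consider "j \<notin> I" | "j \<in> I" "eps n I = 0 \<or> j \<noteq> s" | "j \<in> I" "eps n I = 1" "j = s"
    using eps_0_or_1[of n I] by blast
  then show ?thesis
  proof cases
    case 1
    then have "simple_coord n j a0 = 0" using zero_iff assms(2) by blast
    then show ?thesis using nn assms(2) by simp
  next
    case 2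
    then have "simple_coord n j a0 = 1" using simple_coord_eq_1 assms(2) by blast
    then show ?thesis using pos[OF int nn] zero 2 assms(2) by simp
  next
    case 3
    have "n - 1 \<in> {1..n}" "n \<in> {1..n}" using n by auto
    note z = zero[OF this(1)] zero[OF this(2)]
    have "(n - 1 \<in> I) \<noteq> (n \<in> I)" by (rule ccontr) (use 3 eps_cases[OF n, of I] in simp)
    with s 3 have "(j = n - 1 \<and> n \<notin> I) \<or> (j = n \<and> n - 1 \<notin> I)" by blast
    then have "simple_coord n (n - 1) a + simple_coord n n a = simple_coord n j a"
      using z by auto
    then have "1 \<le> simple_coord n j a / 2"
      using half nn[OF assms(2)] zero[OF assms(2)] 3 by (intro pos) auto
    then show ?thesis using 3 assms(2) by (simp add: c0)
  qed
qed

text \<open>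
  The candidate dominates every element of the set in the order \<open>\<preceq>\<close>, so any maximal element is the
  candidate. It is itself maximal because \<open>\<preceq>\<close> is antisymmetric on the dominant lattice.
\<close>

lemma canonical_iff: "canonical n I \<xi> \<longleftrightarrow> \<xi> = torus_elt n a0"
proof -
  have elt: "\<exists>a. \<xi> = torus_elt n a" if "\<xi> \<in> dominant_lattice n \<inter> cone n I" for \<xi>
    using that by (auto simp: dominant_lattice_def integral_lattice_def torus_eq)
  have le: "preceq n (torus_elt n a) (torus_elt n a0)"
    if "torus_elt n a \<in> dominant_lattice n \<inter> cone n I" for a
    using that integral nonneg least[OF that]
    by (intro preceq_torus_eltI) (auto simp: torus_elt_in_dominant_lattice_iff[OF n])
  have eq: "torus_elt n a = torus_elt n a0"
    if a: "torus_elt n a \<in> dominant_lattice n \<inter> cone n I"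
      and p: "preceq n (torus_elt n a0) (torus_elt n a)" for a
  proof -
    have "\<forall>k\<in>{1..n}. a k \<in> \<int>" using a by (auto simp: torus_elt_in_dominant_lattice_iff[OF n])
    then have "simple_coord n j a = simple_coord n j a0" if "j \<in> {1..n}" for j
      using preceq_torus_eltD[OF n integral _ p that nonneg[OF that]] least[OF a that] by auto
    then show ?thesis by (rule torus_elt_eq_simpleI[OF n])
  qed
  show ?thesis
  proof
    assume "canonical n I \<xi>"
    then have x: "\<xi> \<in> dominant_lattice n \<inter> cone n I"
      and m: "\<forall>\<xi>'\<in>dominant_lattice n \<inter> cone n I. preceq n \<xi> \<xi>' \<longrightarrow> \<xi>' = \<xi>" by (auto simp: canonical_def)
    obtain a where a: "\<xi> = torus_elt n a" using elt[OF x] by blast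
    have "preceq n \<xi> (torus_elt n a0)" using le x unfolding a .
    then show "\<xi> = torus_elt n a0" using bspec[OF m mem] by simp
  next
    assume \<xi>: "\<xi> = torus_elt n a0"
    show "canonical n I \<xi>" unfolding canonical_def \<xi>
    proof (intro conjI ballI impI mem)
      fix \<xi>' assume x: "\<xi>' \<in> dominant_lattice n \<inter> cone n I" and p: "preceq n (torus_elt n a0) \<xi>'"
      obtain a where a: "\<xi>' = torus_elt n a" using elt[OF x] by blast
      show "\<xi>' = torus_elt n a0" using eq x p unfolding a .
    qed
  qed
qed

text \<open>
  Every coefficient before the last two is at most 1, so the coordinates \<open>a\<^sub>i\<close> drop by at most 1 at
  each step, and \<open>a\<^sub>n\<^sub>-\<^sub>1\<close>, half the sum of the last two coefficients, is at most 1.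
\<close>

lemma coord_le:
  assumes "1 \<le> i" "i \<le> n - 1"
  shows "a0 i \<le> real (n - i)"
  using assms(2,1)
proof (induction i rule: inc_induct)
  case base
  have "2 * a0 (n - 1) = 2 * of_bool (n - 1 \<in> I \<or> n \<in> I)"
    unfolding simple_coord_last_sum[OF n, symmetric] by (rule last_sum)
  then have "a0 (n - 1) \<le> 1" by (cases "n - 1 \<in> I \<or> n \<in> I") simp_all
  then show ?case using n by simp
next
  case (step i)
  have "eps n I = 0 \<or> i \<noteq> s" using eps_0_or_1[of n I] s step by fastforce
  then have "simple_coord n i a0 \<le> 1" using step n by (auto simp: c0)
  moreover have "i < n" using step n by simp
  ultimately show ?case using step by (simp add: simple_coord_def of_nat_diff)
qed

end

section \<open>Weights\<close>

text \<open>
  The simple roots are linearly independent over the natural numbers: all of them take the value 1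
  (up to \<open>\<i>\<close>) on the element with coordinates \<open>n - 1, \<dots>, 1, 0\<close>.
\<close>

lemma simple_comb_sum_eq_0:
  assumes "n \<ge> 2" "\<And>a. (\<Sum>i=1..n. real (k i) * simple_coord n i a) = 0" "i \<in> {1..n}"
  shows "k i = 0"
proof -
  have "simple_coord n i (\<lambda>k. real n - real k) = 1" if "i \<in> {1..n}" for i
    using that assms(1) by (auto simp: simple_coord_def)
  then have "(\<Sum>i=1..n. real (k i)) = 0" using assms(2)[of "\<lambda>k. real n - real k"] by simp
  then show ?thesis using assms(3) by (simp add: sum_nonneg_eq_0_iff)
qed

text \<open>
  Antisymmetry is what makes highest and lowest weights unique, so that their definite
  descriptions can be evaluated by exhibiting one.
\<close>

lemma weight_le_antisym:
  assumes "n \<ge> 2" "weight_le n \<mu> \<nu>" "weight_le n \<nu> \<mu>"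
    "\<mu> \<in> extensional (torus n)" "\<nu> \<in> extensional (torus n)"
  shows "\<mu> = \<nu>"
proof -
  obtain k l where k: "\<And>\<xi>. \<xi> \<in> torus n \<Longrightarrow> \<nu> \<xi> - \<mu> \<xi> = (\<Sum>i=1..n. of_nat (k i) * simple_root n i \<xi>)"
    and l: "\<And>\<xi>. \<xi> \<in> torus n \<Longrightarrow> \<mu> \<xi> - \<nu> \<xi> = (\<Sum>i=1..n. of_nat (l i) * simple_root n i \<xi>)"
    using assms(2,3) unfolding weight_le_def by blast
  have sr: "(\<Sum>i=1..n. of_nat (m i) * simple_root n i (torus_elt n a)) =
      \<i> * of_real (\<Sum>i=1..n. real (m i) * simple_coord n i a)" for m a
    using simple_root_torus_elt[OF assms(1)] by (simp add: sum_distrib_left algebra_simps)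
  have "(\<Sum>i=1..n. real (k i + l i) * simple_coord n i a) = 0" for a
  proof -
    have "\<i> * complex_of_real (\<Sum>i=1..n. real (k i + l i) * simple_coord n i a) = 0"
    proof -
      have "\<i> * complex_of_real (\<Sum>i=1..n. real (k i + l i) * simple_coord n i a) =
          (\<Sum>i=1..n. of_nat (k i) * simple_root n i (torus_elt n a)) +
          (\<Sum>i=1..n. of_nat (l i) * simple_root n i (torus_elt n a))"
        unfolding sr[symmetric] by (simp add: sum.distrib ring_distribs)
      also have "\<dots> = 0"
        unfolding k[OF torus_elt_in_torus, symmetric] l[OF torus_elt_in_torus, symmetric] by simp
      finally show ?thesis .
    qed
    then show ?thesis by (simp only: mult_eq_0_iff complex_i_not_zero of_real_eq_0_iff simp_thms)
  qed
  then have "k i + l i = 0" if "i \<in> {1..n}" for i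
    using simple_comb_sum_eq_0[OF assms(1), of "\<lambda>i. k i + l i"] that by simp
  then have "\<mu> \<xi> = \<nu> \<xi>" if "\<xi> \<in> torus n" for \<xi> using k[OF that] by simp
  then show ?thesis using assms(4,5) by (intro extensionalityI) auto
qed

lemma weight_leI:
  assumes "n \<ge> 2" "simple_comb n f" "\<And>a. \<nu> (torus_elt n a) - \<mu> (torus_elt n a) = \<i> * of_real (f a)"
  shows "weight_le n \<mu> \<nu>"
proof -
  obtain k where k: "\<And>a. f a = (\<Sum>i=1..n. real (k i) * simple_coord n i a)"
    using assms(2) unfolding simple_comb_def by blast
  show ?thesis unfolding weight_le_def torus_eq
    using simple_root_torus_elt[OF assms(1)] assms(3)
    by (intro exI[of _ k]) (auto simp: k sum_distrib_left algebra_simps)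
qed

lemma highest_weight_eqI:
  assumes "n \<ge> 2" "\<omega> \<in> weights n V \<rho>" "\<And>\<mu>. \<mu> \<in> weights n V \<rho> \<Longrightarrow> weight_le n \<mu> \<omega>"
  shows "highest_weight n V \<rho> = \<omega>"
  unfolding highest_weight_def
  using assms by (intro the_equality) (auto intro!: weight_le_antisym simp: weights_def)

lemma lowest_weight_eqI:
  assumes "n \<ge> 2" "\<omega> \<in> weights n V \<rho>" "\<And>\<mu>. \<mu> \<in> weights n V \<rho> \<Longrightarrow> weight_le n \<omega> \<mu>"
  shows "lowest_weight n V \<rho> = \<omega>"
  unfolding lowest_weight_def
  using assms by (intro the_equality) (auto intro!: weight_le_antisym simp: weights_def)

lemma simple_comb_first_minus:
  assumes "n \<ge> 2" "r < 2*n"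
  shows "simple_comb n (\<lambda>a. a 1 - coord n r a)"
  using simple_comb_diff[of 1 "r + 1" n] simple_comb_sum[of 1 "r - n + 1" n] assms
  by (cases "r < n") (auto simp: coord_def)

lemma simple_comb_second_minus:
  assumes "n \<ge> 3" "r < 2*n" "r \<noteq> 0"
  shows "simple_comb n (\<lambda>a. a 2 - coord n r a)"
  using simple_comb_diff[of 2 "r + 1" n] simple_comb_sum[of 2 "r - n + 1" n] assms
  by (cases "r < n") (auto simp: coord_def)

text \<open>
  The weight of an entry \<open>(r, c)\<close> is the sum of the two standard weights at \<open>r\<close> and at the conjugate
  of \<open>c\<close>, which are different indices. At most one of the two is \<open>L\<^sub>1\<close>; pair it, if it occurs, with
  \<open>L\<^sub>1\<close> and the other one with \<open>L\<^sub>2\<close>.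
\<close>

lemma simple_comb_highest_root_minus:
  assumes "n \<ge> 3" "p < 2*n" "q < 2*n" "p \<noteq> q"
  shows "simple_comb n (\<lambda>a. a 1 + a 2 - coord n p a - coord n q a)"
proof -
  have *: "simple_comb n (\<lambda>a. a 1 + a 2 - coord n p a - coord n q a)"
    if "p < 2*n" "q < 2*n" "q \<noteq> 0" for p q
  proof -
    have "simple_comb n (\<lambda>a. (a 1 - coord n p a) + (a 2 - coord n q a))"
      using assms(1) that by (intro simple_comb_add simple_comb_first_minus simple_comb_second_minus) auto
    then show ?thesis by (simp add: algebra_simps)
  qed
  show ?thesis using *[of p q] *[of q p] assms by (cases "q = 0") (auto simp: algebra_simps)
qed

definition diag_weight :: "nat \<Rightarrow> nat \<Rightarrow> complex mat \<Rightarrow> complex" where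
  "diag_weight n r = restrict (\<lambda>\<xi>. \<xi> $$ (r, r)) (torus n)"

lemma diag_weight_extensional: "diag_weight n r \<in> extensional (torus n)"
  by (simp add: diag_weight_def)

lemma diag_weight_torus_elt:
  "r < 2*n \<Longrightarrow> diag_weight n r (torus_elt n a) = \<i> * of_real (coord n r a)"
  by (simp add: diag_weight_def torus_elt_index)

lemma torus_elt_mult_vec_index:
  assumes "v \<in> carrier_vec (2*n)" "r < 2*n"
  shows "(torus_elt n a *\<^sub>v v) $ r = \<i> * of_real (coord n r a) * v $ r"
proof -
  have "(torus_elt n a *\<^sub>v v) $ r = (\<Sum>k\<in>{0..<2*n}. (if r = k then \<i> * of_real (coord n r a) else 0) * v $ k)"
    using assms by (auto simp: scalar_prod_def torus_elt_index intro!: sum.cong)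
  then show ?thesis using assms by (simp add: if_distrib[of "\<lambda>x. x * _"] cong: if_cong)
qed

text \<open>
  A simultaneous eigenvector has some nonzero entry, and this entry alone determines the weight.
\<close>

lemma standard_weights:
  "weights n (module_vec TYPE(complex) (2*n)) (\<lambda>X v. X *\<^sub>v v) = diag_weight n ` {..<2*n}"
proof (intro equalityI subsetI)
  fix \<omega> assume "\<omega> \<in> weights n (module_vec TYPE(complex) (2*n)) (\<lambda>X v. X *\<^sub>v v)"
  then obtain v where ext: "\<omega> \<in> extensional (torus n)" and v: "v \<in> carrier_vec (2*n)" "v \<noteq> 0\<^sub>v (2*n)"
    and ev: "\<And>\<xi>. \<xi> \<in> torus n \<Longrightarrow> \<xi> *\<^sub>v v = \<omega> \<xi> \<cdot>\<^sub>v v"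
    by (auto simp: weights_def module_vec_simps)
  from v obtain r where r: "r < 2*n" "v $ r \<noteq> 0" by (metis carrier_vecD eq_vecI index_zero_vec)
  have "\<omega> (torus_elt n a) = \<i> * of_real (coord n r a)" for a
  proof -
    have "\<i> * of_real (coord n r a) * v $ r = \<omega> (torus_elt n a) * v $ r"
      using arg_cong[OF ev[of "torus_elt n a"], of "\<lambda>v. v $ r"] v r
      by (simp add: torus_elt_mult_vec_index del: index_mult_mat_vec)
    then show ?thesis using r by simp
  qed
  then have "\<omega> = diag_weight n r"
    using ext r by (intro extensionalityI[of _ "torus n"])
      (auto simp: diag_weight_torus_elt diag_weight_extensional elim!: torus_eltE)
  then show "\<omega> \<in> diag_weight n ` {..<2*n}" using r by simp
next
  fix \<omega> assume "\<omega> \<in> diag_weight n ` {..<2*n}"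
  then obtain r where r: "r < 2*n" "\<omega> = diag_weight n r" by auto
  have "unit_vec (2*n) r \<noteq> (0\<^sub>v (2*n) :: complex vec)" using r by simp
  moreover have "torus_elt n a *\<^sub>v unit_vec (2*n) r = \<omega> (torus_elt n a) \<cdot>\<^sub>v unit_vec (2*n) r" for a
    using r by (intro eq_vecI) (auto simp: torus_elt_mult_vec_index diag_weight_torus_elt simp del: index_mult_mat_vec)
  ultimately show "\<omega> \<in> weights n (module_vec TYPE(complex) (2*n)) (\<lambda>X v. X *\<^sub>v v)"
    unfolding weights_def using r
    by (auto simp: module_vec_simps torus_eq diag_weight_def intro!: bexI[of _ "unit_vec (2*n) r"])
qed

text \<open>
  The extreme weights are \<open>L\<^sub>1\<close> and \<open>-L\<^sub>1\<close>.
\<close>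

lemma r_standard_torus_elt:
  assumes "n \<ge> 2"
  shows "r_standard n (torus_elt n a) = of_real (2 * a 1)"
proof -
  let ?V = "module_vec TYPE(complex) (2*n)" and ?\<rho> = "\<lambda>X v. X *\<^sub>v v"
  have "highest_weight n ?V ?\<rho> = diag_weight n 0"
  proof (rule highest_weight_eqI[OF assms])
    fix \<mu> assume "\<mu> \<in> weights n ?V ?\<rho>"
    then obtain r where r: "r < 2*n" "\<mu> = diag_weight n r" by (auto simp: standard_weights)
    then show "weight_le n \<mu> (diag_weight n 0)" using assms
      by (intro weight_leI[OF assms simple_comb_first_minus[OF assms r(1)]])
        (simp add: diag_weight_torus_elt coord_def[of n 0] algebra_simps)
  qed (use assms in \<open>auto simp: standard_weights\<close>)
  moreover have "lowest_weight n ?V ?\<rho> = diag_weight n n"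
  proof (rule lowest_weight_eqI[OF assms])
    fix \<mu> assume "\<mu> \<in> weights n ?V ?\<rho>"
    then obtain r where r: "r < 2*n" "\<mu> = diag_weight n r" by (auto simp: standard_weights)
    then show "weight_le n (diag_weight n n) \<mu>" using assms
      by (intro weight_leI[OF assms simple_comb_first_minus[OF assms conj_index_less[OF r(1)]]])
        (simp add: diag_weight_torus_elt coord_def[of n n] algebra_simps)
  qed (use assms in \<open>auto simp: standard_weights\<close>)
  ultimately have "r_standard n (torus_elt n a) =
      1 / \<i> * (diag_weight n 0 (torus_elt n a) - diag_weight n n (torus_elt n a))"
    by (simp only: uniton_r_def)
  also have "\<dots> = of_real (2 * a 1)"
  proof -
    have "diag_weight n 0 (torus_elt n a) = \<i> * of_real (a 1)"
      "diag_weight n n (torus_elt n a) = - (\<i> * of_real (a 1))"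
      using assms by (simp_all add: diag_weight_torus_elt coord_def)
    then show ?thesis by (simp only:) (simp add: algebra_simps)
  qed
  finally show ?thesis .
qed

lemma adjoint_weight_memI:
  assumes "p < 2*n" "q < 2*n" "p \<noteq> conj_index n q"
  shows "restrict (\<lambda>\<xi>. diag_weight n p \<xi> - diag_weight n q \<xi>) (torus n) \<in> weights n (so_2n_C n) ad"
proof -
  note S = Q_skew_root_vec[OF assms(1,2)]
  have "root_vec n p q \<noteq> 0\<^sub>m (2*n) (2*n)" using root_vec_index[OF assms] assms by auto
  moreover have "ad (torus_elt n a) (root_vec n p q) =
      (diag_weight n p (torus_elt n a) - diag_weight n q (torus_elt n a)) \<cdot>\<^sub>m root_vec n p q" for a
  proof (rule eq_matI)
    let ?R = "(diag_weight n p (torus_elt n a) - diag_weight n q (torus_elt n a)) \<cdot>\<^sub>m root_vec n p q"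
    note C = Q_skew_carrier[OF S]
    show "dim_row (ad (torus_elt n a) (root_vec n p q)) = dim_row ?R"
      "dim_col (ad (torus_elt n a) (root_vec n p q)) = dim_col ?R"
      using C ad_torus_elt(1)[OF C, of a] by auto
    fix r c assume "r < dim_row ?R" "c < dim_col ?R"
    then have rc: "r < 2*n" "c < 2*n" using C by auto
    show "ad (torus_elt n a) (root_vec n p q) $$ (r, c) = ?R $$ (r, c)"
    proof (cases "root_vec n p q $$ (r, c) = 0")
      case True then show ?thesis using rc C ad_torus_elt(2)[OF C rc, of a] by simp
    next
      case False
      then show ?thesis
        using rc C assms ad_torus_elt(2)[OF C rc, of a] root_vec_coord[OF assms(1,2) rc False, of a]
        by (simp add: diag_weight_torus_elt right_diff_distrib)
    qed
  qed
  ultimately show ?thesis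
    unfolding weights_def mem_Collect_eq using S
    by (intro conjI bexI[of _ "root_vec n p q"]) (auto simp: so_2n_C_simps carrier_so_2n_C torus_eq)
qed

lemma adjoint_weightE:
  assumes "\<omega> \<in> weights n (so_2n_C n) ad"
  obtains p q where "p < 2*n" "q < 2*n" "p \<noteq> conj_index n q"
    "\<forall>a. \<omega> (torus_elt n a) = \<i> * of_real (coord n p a - coord n q a)"
proof -
  obtain X where X: "Q_skew n X" "X \<noteq> 0\<^sub>m (2*n) (2*n)"
    and ev: "\<And>\<xi>. \<xi> \<in> torus n \<Longrightarrow> ad \<xi> X = \<omega> \<xi> \<cdot>\<^sub>m X"
    using assms by (auto simp: weights_def so_2n_C_simps carrier_so_2n_C)
  note C = Q_skew_carrier[OF X(1)]
  obtain p q where pq: "p < 2*n" "q < 2*n" "X $$ (p, q) \<noteq> 0"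
    using X(2) C by (metis carrier_matD eq_matI index_zero_mat)
  have "\<omega> (torus_elt n a) = \<i> * of_real (coord n p a - coord n q a)" for a
  proof -
    have "\<i> * of_real (coord n p a - coord n q a) * X $$ (p, q) = \<omega> (torus_elt n a) * X $$ (p, q)"
      using arg_cong[OF ev[of "torus_elt n a"], of "\<lambda>X. X $$ (p, q)"] C pq(1,2) ad_torus_elt(2)[OF C pq(1,2), of a]
      by simp
    then show ?thesis using pq(3) by (metis mult_right_cancel)
  qed
  then show ?thesis using that pq Q_skew_nonzero_index[OF X(1) pq] by blast
qed

text \<open>
  The extreme weights are \<open>L\<^sub>1 + L\<^sub>2\<close> and \<open>-L\<^sub>1 - L\<^sub>2\<close>, carried by the entries \<open>(0, n + 1)\<close> and
  \<open>(n + 1, 0)\<close>.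
\<close>

lemma r_adjoint_torus_elt:
  assumes "n \<ge> 3"
  shows "r_adjoint n (torus_elt n a) = of_real (2 * (a 1 + a 2))"
proof -
  have n: "n \<ge> 2" using assms by simp
  let ?hi = "restrict (\<lambda>\<xi>. diag_weight n 0 \<xi> - diag_weight n (n + 1) \<xi>) (torus n)"
  let ?lo = "restrict (\<lambda>\<xi>. diag_weight n (n + 1) \<xi> - diag_weight n 0 \<xi>) (torus n)"
  have hi: "?hi (torus_elt n a) = \<i> * of_real (a 1 + a 2)" and lo: "?lo (torus_elt n a) = - (\<i> * of_real (a 1 + a 2))" for a
    using assms by (simp_all add: diag_weight_torus_elt coord_def ring_distribs numeral_2_eq_2)
  have "highest_weight n (so_2n_C n) ad = ?hi"
  proof (rule highest_weight_eqI[OF n])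
    show "?hi \<in> weights n (so_2n_C n) ad"
      using assms by (intro adjoint_weight_memI) (auto simp: conj_index_def)
    fix \<mu> assume "\<mu> \<in> weights n (so_2n_C n) ad"
    then obtain p q where pq: "p < 2*n" "q < 2*n" "p \<noteq> conj_index n q"
      and \<mu>: "\<forall>a. \<mu> (torus_elt n a) = \<i> * of_real (coord n p a - coord n q a)" by (rule adjoint_weightE)
    show "weight_le n \<mu> ?hi"
      using pq
      by (intro weight_leI[OF n simple_comb_highest_root_minus[OF assms pq(1) conj_index_less[OF pq(2)] pq(3)]])
        (unfold hi, simp add: \<mu> algebra_simps)
  qed
  moreover have "lowest_weight n (so_2n_C n) ad = ?lo"
  proof (rule lowest_weight_eqI[OF n])
    show "?lo \<in> weights n (so_2n_C n) ad"
      using assms by (intro adjoint_weight_memI) (auto simp: conj_index_def)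
    fix \<mu> assume "\<mu> \<in> weights n (so_2n_C n) ad"
    then obtain p q where pq: "p < 2*n" "q < 2*n" "p \<noteq> conj_index n q"
      and \<mu>: "\<forall>a. \<mu> (torus_elt n a) = \<i> * of_real (coord n p a - coord n q a)" by (rule adjoint_weightE)
    have "conj_index n p \<noteq> q" using pq by auto
    then show "weight_le n ?lo \<mu>"
      using pq
      by (intro weight_leI[OF n simple_comb_highest_root_minus[OF assms conj_index_less[OF pq(1)] pq(2)]])
        (unfold lo, simp_all add: \<mu> algebra_simps)
  qed
  ultimately show ?thesis
    unfolding uniton_r_def by (simp only: hi lo) (simp add: algebra_simps)
qed

theorem proposition6p10:
  fixes n s :: nat and I :: "nat set"
  assumes "n \<ge> 3" and "I \<subseteq> {1..n}"
    and "eps n I = 1 \<Longrightarrow> s \<in> {n-1, n} \<inter> I"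
  shows "{\<xi>. canonical n I \<xi>} = {xi n I + of_nat (eps n I) \<cdot>\<^sub>m H n s} \<and>
    r_standard n (xi n I + of_nat (eps n I) \<cdot>\<^sub>m H n s) \<le> 2 * of_nat n - 2 \<and>
    r_adjoint n (xi n I + of_nat (eps n I) \<cdot>\<^sub>m H n s) \<le> 4 * of_nat n - 6"
proof -
  have n: "n \<ge> 2" using assms(1) by simp
  obtain a where elt: "xi n I + of_nat (eps n I) \<cdot>\<^sub>m H n s = torus_elt n a"
    and c: "\<And>j. j \<in> {1..n} \<Longrightarrow> simple_coord n j a = of_bool (j \<in> I) + real (eps n I) * of_bool (j = s)"
    using candidate_coords[OF n assms(2,3)] by metis
  interpret candidate n s I a
    using n assms(2,3) c by unfold_locales
  have a1: "a 1 \<le> real n - 1" and a2: "a 2 \<le> real n - 2"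
    using coord_le[of 1] coord_le[of 2] assms(1) by auto
  have "{\<xi>. canonical n I \<xi>} = {torus_elt n a}" using canonical_iff by auto
  moreover have "r_standard n (torus_elt n a) \<le> 2 * of_nat n - 2"
    using a1 unfolding r_standard_torus_elt[OF n] by (simp add: less_eq_complex_def)
  moreover have "r_adjoint n (torus_elt n a) \<le> 4 * of_nat n - 6"
    using a1 a2 unfolding r_adjoint_torus_elt[OF assms(1)] by (simp add: less_eq_complex_def)
  ultimately show ?thesis unfolding elt by blast
qed

end
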